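(* Let $\Sigma$ be a linear time-and-space-invariant (LTSI) system with operators $(\mathcal{A},\mathcal{B},\mathcal{C})$ (see context). If $\Sigma$ is internally of relaxation type, then it is impedance passive with storage $\mathcal{S}:\mathcal{Z}\to\mathbb{R}_+$ given by $\mathcal{S}(z)=\|z\|^2$. Furthermore, $$\mathcal{S}(z(0))=\int_0^\infty\langle u(-t),y(t)\rangle\,dt,$$ where $z:\mathbb{R}\to\mathcal{Z}$ and $y:\mathbb{R}\to\mathcal{Y}$ are the state and output trajectories corresponding to the input trajectory $u:\mathbb{R}\to\mathcal{U}$ such that $u(t)=0$ for $t\ge0$.
   Context: **Notation.** All Hilbert spaces are complex; $\mathscr{B}(\mathcal{X},\mathcal{Y})$ denotes the bounded linear operators from $\mathcal{X}$ to $\mathcal{Y}$, and $\mathscr{B}(\mathcal{X})=\mathscr{B}(\mathcal{X},\mathcal{X})$. For a (possibly unbounded) densely defined operator $T$, $T\ge 0$ means that $T$ is self-adjoint and $\langle Tx,x\rangle\ge 0$ for all $x$ in its domain; $T\le 0$ means $-T\ge 0$. $^*$ denotes the adjoint. **LTSI systems.** Let $\mathcal{U}=L_2(\mathbb{R}^s,\mathbb{C}^m)$, $\mathcal{Z}=L_2(\mathbb{R}^s,\mathbb{C}^n)$, $\mathcal{Y}=L_2(\mathbb{R}^s,\mathbb{C}^p)$. An LTSI system $\Sigma$ is given by $\frac{d}{dt}z(t)=\mathcal{A}z(t)+\mathcal{B}u(t)$, $y(t)=\mathcal{C}z(t)$, where $\mathcal{A}:\mathscr{D}(\mathcal{A})\subset\mathcal{Z}\to\mathcal{Z}$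 is densely defined and is the infinitesimal generator of a $C_0$-semigroup $t\mapsto\exp(\mathcal{A}t)\in\mathscr{B}(\mathcal{Z})$, $\mathcal{B}\in\mathscr{B}(\mathcal{U},\mathcal{Z})$, $\mathcal{C}\in\mathscr{B}(\mathcal{Z},\mathcal{Y})$, and $\mathcal{A},\mathcal{B},\mathcal{C}$ are translation-invariant. Here, with $(\mathcal{T}_{\bar x}f)(x)=f(x+\bar x)$, an operator is translation-invariant if $\mathcal{T}_{\bar x}$ maps its domain into its domain and it commutes with translations by every $\bar x\in\mathbb{R}^s$. With $\mathcal{F}$ the unitary Fourier transform on $L_2(\mathbb{R}^s,\cdot)$, the operators $\mathcal{F}\mathcal{A}\mathcal{F}^*$, $\mathcal{F}\mathcal{B}\mathcal{F}^*$, $\mathcal{F}\mathcal{C}\mathcal{F}^*$ are multiplication operators by matrix-valued functions (symbols) of $\omega\in\mathbb{R}^s$, and it is a standing assumption that these symbols are continuous. **Trajectories.** For an input trajectory $u:\mathbb{R}\to\mathcal{U}$ on the whole time axis, the system is assumed initially at rest ($z(-\infty)=0$), so that the corresponding state and output trajectories are $z(t)=\int_{-\infty}^t\exp(\mathcal{A}(t-\tau))\mathcal{B}u(\tau)\,d\tau$ and $y(t)=\mathcal{C}z(t)=\int_{-\infty}^t\mathcal{C}\exp(\mathcal{A}(t-\tau))\mathcal{B}u(\tau)\,d\tau$; $u$ is understood to be such that these (Bochner) integrals are well defined. On $[0,\infty)$ with initial state $z(0)$, solutions are mild solutions $z(t)=\exp(\mathcal{A}t)z(0)+\int_0^t\exp(\mathcal{A}(t-\tau))\mathcal{B}u(\tau)\,d\tau$.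 **Internal relaxation.** $\Sigma$ is internally of relaxation type if $\mathcal{A}\le0$ and $\mathcal{B}=\mathcal{C}^*$ (in particular $\mathcal{U}=\mathcal{Y}$). **Impedance passivity.** $\Sigma$ is impedance passive if $\mathcal{U}=\mathcal{Y}$ and there exists a storage functional $\mathcal{S}:\mathcal{Z}\to\mathbb{R}_+$ of the form $\mathcal{S}(z)=\langle\mathcal{Q}z,z\rangle$ with $\mathcal{Q}\in\mathscr{B}(\mathcal{Z})$, $\mathcal{Q}\ge0$, such that $$\mathcal{S}(z(t))\le\mathcal{S}(z(0))+\int_0^t\langle u(\tau),y(\tau)\rangle+\langle y(\tau),u(\tau)\rangle\,d\tau$$ for all $z(0)\in\mathcal{Z}$, $t\ge0$ and $u\in L_2([0,t],\mathcal{U})$. "Impedance passive with storage $\mathcal{S}$" means this holds for that particular $\mathcal{S}$. *)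

theory Defs
  imports "HOL-Analysis.Analysis"
begin

text \<open>
  \<open>('s, 'm) L2\<close> is $L_2(R^s, C^m)$ with $s$, $m$ the cardinalities of \<open>'s\<close>, \<open>'m\<close>: square-integrable Borel
  functions modulo almost-everywhere equality.  It is made an instance of \<^class>\<open>banach\<close> and
  \<^class>\<open>second_countable_topology\<close>, so that the Bochner integral of the library applies to
  \<open>L2\<close>-valued trajectories.
\<close>

definition square_integrable :: "(real ^ 's \<Rightarrow> complex ^ 'm) \<Rightarrow> bool" where
  "square_integrable f \<longleftrightarrow>
     f \<in> borel_measurable lborel \<and> integrable lborel (\<lambda>x. (norm (f x))\<^sup>2)"

definition L2_eq :: "(real ^ 's \<Rightarrow> complex ^ 'm) \<Rightarrow> (real ^ 's \<Rightarrow> complex ^ 'm) \<Rightarrow> bool" where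
  "L2_eq f g \<longleftrightarrow>
     square_integrable f \<and> square_integrable g \<and> (AE x in lborel. f x = g x)"

lemma square_integrable_measurable [measurable_dest]:
  "square_integrable f \<Longrightarrow> f \<in> borel_measurable borel"
  by (simp add: square_integrable_def)

lemma square_integrable_zero: "square_integrable (\<lambda>x. 0)"
  by (simp add: square_integrable_def)

lemma square_integrable_add:
  assumes "square_integrable f" "square_integrable g"
  shows "square_integrable (\<lambda>x. f x + g x)"
proof -
  note [measurable] = square_integrable_measurable[OF assms(1)] square_integrable_measurable[OF assms(2)]
  have "integrable lborel (\<lambda>x. (norm (f x + g x))\<^sup>2)"
  proof (rule Bochner_Integration.integrable_bound)
    show "integrable lborel (\<lambda>x. 2 * (norm (f x))\<^sup>2 + 2 * (norm (g x))\<^sup>2)"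
      using assms by (auto simp: square_integrable_def)
    have "(norm (f x + g x))\<^sup>2 \<le> 2 * (norm (f x))\<^sup>2 + 2 * (norm (g x))\<^sup>2" for x
    proof -
      have "(norm (f x + g x))\<^sup>2 \<le> (norm (f x) + norm (g x))\<^sup>2"
        by (intro power_mono norm_triangle_ineq) auto
      also have "\<dots> \<le> 2 * (norm (f x))\<^sup>2 + 2 * (norm (g x))\<^sup>2"
        using sum_squares_bound[of "norm (f x)" "norm (g x)"] by (simp add: power2_sum)
      finally show ?thesis .
    qed
    then show "AE x in lborel. norm ((norm (f x + g x))\<^sup>2)
                 \<le> norm (2 * (norm (f x))\<^sup>2 + 2 * (norm (g x))\<^sup>2)"
      by auto
  qed auto
  then show ?thesis
    by (simp add: square_integrable_def)
qed

lemma norm_vector_scalar_mult: "norm (c *s v) = cmod c * norm v" for v :: "complex ^ 'm"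
  by (simp add: norm_vec_def norm_mult L2_set_right_distrib)

lemma continuous_on_vector_scalar_mult: "continuous_on UNIV (\<lambda>v :: complex ^ 'm. c *s v)"
  unfolding vector_scalar_mult_def by (intro continuous_intros)

lemma square_integrable_scaleC:
  assumes "square_integrable f"
  shows "square_integrable (\<lambda>x. c *s f x)"
proof -
  note [measurable] = square_integrable_measurable[OF assms]
  have "(\<lambda>x. c *s f x) \<in> borel_measurable borel"
    using borel_measurable_continuous_onI[OF continuous_on_vector_scalar_mult] by measurable
  with assms show ?thesis
    by (simp add: square_integrable_def norm_vector_scalar_mult power_mult_distrib)
qed

lemma square_integrable_scaleR:
  "square_integrable f \<Longrightarrow> square_integrable (\<lambda>x. r *\<^sub>R f x)"
  by (auto simp: square_integrable_def power_mult_distrib)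

lemma square_integrable_translate:
  assumes "square_integrable f"
  shows "square_integrable (\<lambda>x. f (x + h))"
proof -
  note [measurable] = square_integrable_measurable[OF assms]
  have "integrable (distr lborel borel ((+) h)) (\<lambda>x. (norm (f x))\<^sup>2)"
    using assms by (simp add: lborel_distr_plus square_integrable_def)
  then have "integrable lborel (\<lambda>x. (norm (f (h + x)))\<^sup>2)"
    by (subst (asm) integrable_distr_eq) auto
  then show ?thesis
    by (simp add: square_integrable_def add.commute)
qed

lemma integrable_inner_square_integrable:
  assumes "square_integrable f" "square_integrable g"
  shows "integrable lborel (\<lambda>x. f x \<bullet> g x)"
proof (rule Bochner_Integration.integrable_bound)
  note [measurable] = square_integrable_measurable[OF assms(1)] square_integrable_measurable[OF assms(2)]
  show "integrable lborel (\<lambda>x. (norm (f x))\<^sup>2 + (norm (g x))\<^sup>2)"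
    using assms by (auto simp: square_integrable_def)
  show "(\<lambda>x. f x \<bullet> g x) \<in> borel_measurable lborel"
    by simp
  have "\<bar>f x \<bullet> g x\<bar> \<le> (norm (f x))\<^sup>2 + (norm (g x))\<^sup>2" for x
    using Cauchy_Schwarz_ineq2[of "f x" "g x"] sum_squares_bound[of "norm (f x)" "norm (g x)"]
      mult_nonneg_nonneg[OF norm_ge_zero[of "f x"] norm_ge_zero[of "g x"]] by linarith
  then show "AE x in lborel. norm (f x \<bullet> g x) \<le> norm ((norm (f x))\<^sup>2 + (norm (g x))\<^sup>2)"
    by (auto intro: order_trans[OF _ abs_ge_self])
qed

lemma measurable_hermitian:
  fixes f g :: "real ^ 's \<Rightarrow> complex ^ 'm"
  assumes "f \<in> borel_measurable borel" "g \<in> borel_measurable borel"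
  shows "(\<lambda>x. \<Sum>i\<in>UNIV. f x $ i * cnj (g x $ i)) \<in> borel_measurable borel"
proof (rule borel_measurable_continuous_Pair[OF assms])
  show "continuous_on UNIV (\<lambda>p :: (complex ^ 'm) \<times> (complex ^ 'm). \<Sum>i\<in>UNIV. fst p $ i * cnj (snd p $ i))"
    by (intro continuous_intros)
qed

quotient_type ('s, 'm) L2 = "real ^ 's \<Rightarrow> complex ^ 'm" / partial: L2_eq
proof (rule part_equivpI)
  show "\<exists>f. L2_eq f f"
    using square_integrable_zero by (auto simp: L2_eq_def)
  show "symp L2_eq"
    by (auto simp: symp_def L2_eq_def)
  show "transp L2_eq"
    by (auto simp: transp_def L2_eq_def)
qed

lemma L2_eq_refl: "L2_eq f f \<longleftrightarrow> square_integrable f"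
  by (simp add: L2_eq_def)

lemma square_integrable_rep_L2: "square_integrable (rep_L2 f)"
  using Quotient_rep_reflp[OF Quotient_L2, of f] by (simp add: L2_eq_refl)

lemma rep_abs_L2: "square_integrable h \<Longrightarrow> AE x in lborel. rep_L2 (abs_L2 h) x = h x"
  using rep_abs_rsp_left[OF Quotient3_L2, of h h] by (simp add: L2_eq_def)

lift_definition cinner :: "('s::finite, 'm::finite) L2 \<Rightarrow> ('s, 'm) L2 \<Rightarrow> complex"
  is "\<lambda>f g. LINT x|lborel. (\<Sum>i\<in>UNIV. f x $ i * cnj (g x $ i))"
proof -
  fix f f' g g' :: "real ^ 's \<Rightarrow> complex ^ 'm"
  assume *: "L2_eq f f'" "L2_eq g g'"
  then have m: "f \<in> borel_measurable borel" "g \<in> borel_measurable borel"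
    "f' \<in> borel_measurable borel" "g' \<in> borel_measurable borel"
    by (auto simp: L2_eq_def square_integrable_measurable)
  show "(LINT x|lborel. (\<Sum>i\<in>UNIV. f x $ i * cnj (g x $ i))) =
        (LINT x|lborel. (\<Sum>i\<in>UNIV. f' x $ i * cnj (g' x $ i)))"
  proof (rule integral_cong_AE)
    show "AE x in lborel. (\<Sum>i\<in>UNIV. f x $ i * cnj (g x $ i)) =
            (\<Sum>i\<in>UNIV. f' x $ i * cnj (g' x $ i))"
      using * by (auto simp: L2_eq_def)
  qed (simp_all add: m measurable_hermitian)
qed

lift_definition scaleC :: "complex \<Rightarrow> ('s::finite, 'm::finite) L2 \<Rightarrow> ('s, 'm) L2"
  is "\<lambda>c f x. c *s f x"
  by (auto simp: L2_eq_def square_integrable_scaleC)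

lift_definition translate :: "real ^ 's \<Rightarrow> ('s::finite, 'm::finite) L2 \<Rightarrow> ('s, 'm) L2"
  is "\<lambda>h f x. f (x + h)"
proof -
  fix h :: "real ^ 's" and f g :: "real ^ 's \<Rightarrow> complex ^ 'm"
  assume "L2_eq f g"
  moreover from this have "AE x in lborel. f (x + h) = g (x + h)" 
  proof -
    have [measurable]: "f \<in> borel_measurable borel" "g \<in> borel_measurable borel"
      using \<open>L2_eq f g\<close> by (auto simp: L2_eq_def square_integrable_measurable)
    have "AE x in distr lborel borel ((+) h). f x = g x"
      using \<open>L2_eq f g\<close> unfolding lborel_distr_plus by (simp add: L2_eq_def)
    then show ?thesis
      by (subst (asm) AE_distr_iff) (auto simp: add.commute)
  qed
  ultimately show "L2_eq (\<lambda>x. f (x + h)) (\<lambda>x. g (x + h))"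
    by (auto simp: L2_eq_def square_integrable_translate)
qed

instantiation L2 :: (finite, finite) real_inner
begin

lift_definition zero_L2 :: "('a, 'b) L2" is "\<lambda>x. 0"
  by (simp add: L2_eq_def square_integrable_zero)

lift_definition plus_L2 :: "('a, 'b) L2 \<Rightarrow> ('a, 'b) L2 \<Rightarrow> ('a, 'b) L2" is "\<lambda>f g x. f x + g x"
  by (auto simp: L2_eq_def square_integrable_add)

lift_definition scaleR_L2 :: "real \<Rightarrow> ('a, 'b) L2 \<Rightarrow> ('a, 'b) L2" is "\<lambda>r f x. r *\<^sub>R f x"
  by (auto simp: L2_eq_def square_integrable_scaleR)

definition uminus_L2 :: "('a, 'b) L2 \<Rightarrow> ('a, 'b) L2" where
  "uminus_L2 f = (-1) *\<^sub>R f"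

definition minus_L2 :: "('a, 'b) L2 \<Rightarrow> ('a, 'b) L2 \<Rightarrow> ('a, 'b) L2" where
  "minus_L2 f g = f + (-1) *\<^sub>R g"

lift_definition inner_L2 :: "('a, 'b) L2 \<Rightarrow> ('a, 'b) L2 \<Rightarrow> real"
  is "\<lambda>f g. LINT x|lborel. f x \<bullet> g x"
proof -
  fix f f' g g' :: "real ^ 'a \<Rightarrow> complex ^ 'b"
  assume *: "L2_eq f f'" "L2_eq g g'"
  then have [measurable]: "f \<in> borel_measurable borel" "g \<in> borel_measurable borel"
    "f' \<in> borel_measurable borel" "g' \<in> borel_measurable borel"
    by (auto simp: L2_eq_def square_integrable_measurable)
  show "(LINT x|lborel. f x \<bullet> g x) = (LINT x|lborel. f' x \<bullet> g' x)"
    using * by (intro integral_cong_AE) (auto simp: L2_eq_def)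
qed

definition norm_L2 :: "('a, 'b) L2 \<Rightarrow> real" where
  "norm_L2 f = sqrt (f \<bullet> f)"

definition sgn_L2 :: "('a, 'b) L2 \<Rightarrow> ('a, 'b) L2" where
  "sgn_L2 f = inverse (norm f) *\<^sub>R f"

definition dist_L2 :: "('a, 'b) L2 \<Rightarrow> ('a, 'b) L2 \<Rightarrow> real" where
  "dist_L2 f g = norm (f - g)"

definition uniformity_L2 :: "(('a, 'b) L2 \<times> ('a, 'b) L2) filter" where
  "uniformity_L2 = (INF e\<in>{0<..}. principal {(f, g). dist f g < e})"

definition open_L2 :: "('a, 'b) L2 set \<Rightarrow> bool" where
  "open_L2 S \<longleftrightarrow> (\<forall>f\<in>S. \<forall>\<^sub>F (f', g) in uniformity. f' = f \<longrightarrow> g \<in> S)"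

instance
proof
  fix f g h :: "('a, 'b) L2" and r r' :: real
  show "f + g + h = f + (g + h)"
    by transfer (auto simp: L2_eq_def add.assoc intro!: square_integrable_add)
  show "f + g = g + f"
    by transfer (auto simp: L2_eq_def add.commute intro!: square_integrable_add)
  show "0 + f = f"
    by transfer (auto simp: L2_eq_def)
  show "- f + f = 0"
    unfolding uminus_L2_def
    by transfer (auto simp: L2_eq_def square_integrable_zero)
  show "f - g = f + - g"
    by (simp add: uminus_L2_def minus_L2_def)
  show "r *\<^sub>R (f + g) = r *\<^sub>R f + r *\<^sub>R g"
    by transfer (auto simp: L2_eq_def scaleR_add_right
        intro!: square_integrable_add square_integrable_scaleR)
  show "(r + r') *\<^sub>R f = r *\<^sub>R f + r' *\<^sub>R f"
    by transfer (auto simp: L2_eq_def scaleR_add_left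
        intro!: square_integrable_add square_integrable_scaleR)
  show "r *\<^sub>R r' *\<^sub>R f = (r * r') *\<^sub>R f"
    by transfer (auto simp: L2_eq_def intro!: square_integrable_scaleR)
  show "1 *\<^sub>R f = f"
    by transfer (auto simp: L2_eq_def)
  show "f \<bullet> g = g \<bullet> f"
    by transfer (auto simp: inner_commute)
  show "(f + g) \<bullet> h = f \<bullet> h + g \<bullet> h"
    by transfer (auto simp: L2_eq_refl inner_add_left integrable_inner_square_integrable)
  show "(r *\<^sub>R f) \<bullet> g = r * (f \<bullet> g)"
    by transfer auto
  show "0 \<le> f \<bullet> f"
    by transfer auto
  show "(f \<bullet> f = 0) = (f = 0)"
  proof transfer
    fix f :: "real ^ 'a \<Rightarrow> complex ^ 'b" assume f: "L2_eq f f"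
    then have "integrable lborel (\<lambda>x. f x \<bullet> f x)"
      by (auto simp: L2_eq_refl integrable_inner_square_integrable)
    from integral_nonneg_eq_0_iff_AE[OF this]
    show "((LINT x|lborel. f x \<bullet> f x) = 0) = L2_eq f (\<lambda>x. 0)"
      using f by (simp add: L2_eq_def square_integrable_zero)
  qed
qed (simp_all add: norm_L2_def sgn_L2_def dist_L2_def uniformity_L2_def open_L2_def)

end

lemma rep_L2_plus: "AE x in lborel. rep_L2 (f + g) x = rep_L2 f x + rep_L2 g x"
proof -
  have "f + g = abs_L2 (\<lambda>x. rep_L2 f x + rep_L2 g x)"
    by (simp add: plus_L2_def)
  then show ?thesis
    using rep_abs_L2[OF square_integrable_add[OF square_integrable_rep_L2[of f] square_integrable_rep_L2[of g]]]
    by simp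
qed

lemma rep_L2_scaleR: "AE x in lborel. rep_L2 (r *\<^sub>R f) x = r *\<^sub>R rep_L2 f x"
proof -
  have "r *\<^sub>R f = abs_L2 (\<lambda>x. r *\<^sub>R rep_L2 f x)"
    by (simp add: scaleR_L2_def)
  then show ?thesis
    using rep_abs_L2[OF square_integrable_scaleR[OF square_integrable_rep_L2[of f], of r]]
    by simp
qed

lemma rep_L2_minus: "AE x in lborel. rep_L2 (f - g) x = rep_L2 f x - rep_L2 g x"
proof -
  have eq: "f - g = f + (-1) *\<^sub>R g" by simp
  show ?thesis
    unfolding eq using rep_L2_plus[of f "(-1) *\<^sub>R g"] rep_L2_scaleR[of "-1" g] by auto
qed

lemma norm_L2_eq: "(norm f)\<^sup>2 = (LINT x|lborel. (norm (rep_L2 f x))\<^sup>2)"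
proof -
  have "f \<bullet> f = (LINT x|lborel. rep_L2 f x \<bullet> rep_L2 f x)"
    by (simp add: inner_L2_def)
  then show ?thesis
    by (simp add: power2_norm_eq_inner)
qed

lemma nn_integral_rep_L2: "(\<integral>\<^sup>+x. ennreal ((norm (rep_L2 f x))\<^sup>2) \<partial>lborel) = ennreal ((norm f)\<^sup>2)"
  unfolding norm_L2_eq using square_integrable_rep_L2[of f]
  by (intro nn_integral_eq_integral) (auto simp: square_integrable_def)

lemma rep_L2_measurable [measurable]: "rep_L2 f \<in> borel_measurable borel"
  by (intro square_integrable_measurable square_integrable_rep_L2)

lemma nn_integral_rep_L2_diff:
  "(\<integral>\<^sup>+x. ennreal ((norm (rep_L2 f x - rep_L2 g x))\<^sup>2) \<partial>lborel) = ennreal ((norm (f - g))\<^sup>2)"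
proof -
  have "(\<integral>\<^sup>+x. ennreal ((norm (rep_L2 f x - rep_L2 g x))\<^sup>2) \<partial>lborel) =
        (\<integral>\<^sup>+x. ennreal ((norm (rep_L2 (f - g) x))\<^sup>2) \<partial>lborel)"
    using rep_L2_minus[of f g] by (intro nn_integral_cong_AE) auto
  then show ?thesis
    by (simp add: nn_integral_rep_L2)
qed

lemma square_integrableI_nn:
  assumes "f \<in> borel_measurable borel" "(\<integral>\<^sup>+x. ennreal ((norm (f x))\<^sup>2) \<partial>lborel) < \<infinity>"
  shows "square_integrable f"
  using assms by (auto simp: square_integrable_def intro!: integrableI_bounded)

lemma norm_abs_L2_diff:
  assumes "square_integrable f" "square_integrable g"
  shows "ennreal ((norm (abs_L2 f - abs_L2 g))\<^sup>2) = (\<integral>\<^sup>+x. ennreal ((norm (f x - g x))\<^sup>2) \<partial>lborel)"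
  unfolding nn_integral_rep_L2_diff[symmetric]
  using rep_abs_L2[OF assms(1)] rep_abs_L2[OF assms(2)] by (intro nn_integral_cong_AE) auto

lemma abs_rep_L2: "abs_L2 (rep_L2 f) = f"
  by (rule Quotient_abs_rep[OF Quotient_L2])

lemma L2_complete:
  fixes X :: "nat \<Rightarrow> ('s::finite, 'm::finite) L2"
  assumes X: "Cauchy X"
  shows "convergent X"
proof -
  have "\<forall>k. \<exists>N. \<forall>m\<ge>N. \<forall>n\<ge>N. norm (X m - X n) < (1/2)^k"
    using X unfolding Cauchy_iff by simp
  then obtain N where N: "\<And>k m n. m \<ge> N k \<Longrightarrow> n \<ge> N k \<Longrightarrow> norm (X m - X n) < (1/2)^k"
    by metis
  define r where "r k = (\<Sum>j\<le>k. N j) + k" for k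
  have r_ge: "N k \<le> r k" for k
    using member_le_sum[of k "{..k}" N] by (simp add: r_def trans_le_add1)
  have r_ge': "k \<le> r k" for k by (simp add: r_def)
  have r_ge'': "N k \<le> r (Suc k)" for k
    using r_ge[of k] by (simp add: r_def)
  have d: "norm (X (r (Suc k)) - X (r k)) < (1/2)^k" for k
    using N[of k] r_ge[of k] r_ge''[of k] by auto
  define F where "F k = rep_L2 (X (r k))" for k
  have [measurable]: "F k \<in> borel_measurable borel" for k by (simp add: F_def)
  define D where "D k x = 2^k * (norm (F (Suc k) x - F k x))\<^sup>2" for k x
  have [measurable]: "D k \<in> borel_measurable borel" for k unfolding D_def by measurable
  have D0: "D k x \<ge> 0" for k x by (simp add: D_def)
  have "(\<integral>\<^sup>+x. (\<Sum>k. ennreal (D k x)) \<partial>lborel) = (\<Sum>k. \<integral>\<^sup>+x. ennreal (D k x) \<partial>lborel)"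
    by (intro nn_integral_suminf) auto
  also have "\<dots> \<le> (\<Sum>k. ennreal ((1/2)^k))"
  proof (intro suminf_le)
    fix k
    have "(\<integral>\<^sup>+x. ennreal (D k x) \<partial>lborel) = 2^k * ennreal ((norm (X (r (Suc k)) - X (r k)))\<^sup>2)"
      unfolding D_def F_def
      by (subst nn_integral_rep_L2_diff[symmetric], subst nn_integral_cmult[symmetric])
         (auto simp: ennreal_mult' ennreal_power[symmetric] ennreal_numeral[symmetric] simp del: ennreal_numeral)
    also have "\<dots> = ennreal (2^k * (norm (X (r (Suc k)) - X (r k)))\<^sup>2)"
      by (auto simp: ennreal_mult' ennreal_power[symmetric] ennreal_numeral[symmetric] simp del: ennreal_numeral)
    also have "\<dots> \<le> ennreal (2^k * ((1/2)^k)\<^sup>2)"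
      using d[of k] by (intro ennreal_leI mult_left_mono power_mono) auto
    also have "(2::real)^k * ((1/2)^k)\<^sup>2 = (1/2)^k"
      by (simp add: power2_eq_square power_one_over)
    finally show "(\<integral>\<^sup>+x. ennreal (D k x) \<partial>lborel) \<le> ennreal ((1/2)^k)" .
  qed auto
  also have "\<dots> < \<infinity>"
    by (subst suminf_ennreal2) (auto intro!: summable_geometric)
  finally have "AE x in lborel. (\<Sum>k. ennreal (D k x)) \<noteq> \<infinity>"
    by (intro nn_integral_PInf_AE) auto
  then have conv: "AE x in lborel. convergent (\<lambda>k. F k x)"
  proof eventually_elim
    case (elim x)
    then have "summable (\<lambda>k. D k x)"
      using D0 by (metis summable_suminf_not_top infinity_ennreal_def)
    then have "(\<lambda>k. D k x) \<longlonglongrightarrow> 0"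
      by (rule summable_LIMSEQ_zero)
    then have "Bseq (\<lambda>k. D k x)"
      by (meson convergent_def convergent_imp_Bseq)
    then obtain K where K: "K > 0" "\<And>k. D k x \<le> K"
      unfolding Bseq_def by (metis D0 abs_of_nonneg real_norm_def)
    have le: "norm (F (Suc k) x - F k x) \<le> sqrt K * (sqrt (1/2))^k" for k
    proof -
      have "(norm (F (Suc k) x - F k x))\<^sup>2 \<le> K * (1/2)^k"
        using K(2)[of k] by (simp add: D_def field_simps power_one_over)
      then have "norm (F (Suc k) x - F k x) \<le> sqrt (K * (1/2)^k)"
        by (rule real_le_rsqrt)
      then show ?thesis by (simp add: real_sqrt_mult real_sqrt_power)
    qed
    have "summable (\<lambda>k. F (Suc k) x - F k x)"
      by (rule summable_comparison_test'[OF _ le])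
         (auto intro!: summable_mult summable_geometric)
    then have "convergent (\<lambda>n. \<Sum>k<n. F (Suc k) x - F k x)"
      by (simp add: summable_iff_convergent)
    then have "convergent (\<lambda>n. (F n x - F 0 x))"
      by (simp only: sum_lessThan_telescope[of "\<lambda>k. F k x"])
    then have "convergent (\<lambda>n. (F n x - F 0 x) + F 0 x)"
      by (intro convergent_add convergent_const)
    then show ?case by simp
  qed
  define f where "f x = lim (\<lambda>k. F k x)" for x
  have f_meas [measurable]: "f \<in> borel_measurable borel"
    unfolding f_def by measurable
  have F_lim: "AE x in lborel. (\<lambda>k. F k x) \<longlonglongrightarrow> f x"
    using conv by eventually_elim (simp add: f_def convergent_LIMSEQ_iff)
  have le: "(\<integral>\<^sup>+x. ennreal ((norm (f x - rep_L2 (X n) x))\<^sup>2) \<partial>lborel) \<le> ennreal (((1/2)^j)\<^sup>2)"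
    if "n \<ge> N j" for j n
  proof -
    have "(\<integral>\<^sup>+x. ennreal ((norm (f x - rep_L2 (X n) x))\<^sup>2) \<partial>lborel) =
          (\<integral>\<^sup>+x. liminf (\<lambda>k. ennreal ((norm (F k x - rep_L2 (X n) x))\<^sup>2)) \<partial>lborel)"
    proof (intro nn_integral_cong_AE)
      show "AE x in lborel. ennreal ((norm (f x - rep_L2 (X n) x))\<^sup>2) =
              liminf (\<lambda>k. ennreal ((norm (F k x - rep_L2 (X n) x))\<^sup>2))"
        using F_lim
      proof eventually_elim
        case (elim x)
        have "(\<lambda>k. ennreal ((norm (F k x - rep_L2 (X n) x))\<^sup>2)) \<longlonglongrightarrow> ennreal ((norm (f x - rep_L2 (X n) x))\<^sup>2)"
          by (intro tendsto_intros elim tendsto_ennrealI)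
        then show ?case by (intro lim_imp_Liminf[symmetric]) auto
      qed
    qed
    also have "\<dots> \<le> liminf (\<lambda>k. \<integral>\<^sup>+x. ennreal ((norm (F k x - rep_L2 (X n) x))\<^sup>2) \<partial>lborel)"
      by (intro nn_integral_liminf) auto
    also have "\<dots> = liminf (\<lambda>k. ennreal ((norm (X (r k) - X n))\<^sup>2))"
      by (simp add: F_def nn_integral_rep_L2_diff)
    also have "\<dots> \<le> liminf (\<lambda>k::nat. ennreal (((1/2)^j)\<^sup>2))"
    proof (intro Liminf_mono eventually_sequentiallyI[of "N j"] ennreal_leI power_mono)
      fix k assume "N j \<le> k"
      then show "norm (X (r k) - X n) \<le> (1/2)^j"
        using N[of j "r k" n] r_ge'[of k] that by auto
    qed auto
    finally show ?thesis by (simp add: Liminf_const)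
  qed
  have "square_integrable (\<lambda>x. f x - rep_L2 (X (N 0)) x)"
    using le[of 0 "N 0"] by (intro square_integrableI_nn) (auto simp: order_le_less_trans)
  from square_integrable_add[OF this square_integrable_rep_L2[of "X (N 0)"]]
  have f: "square_integrable f" by simp
  have lim: "norm (abs_L2 f - X n) \<le> (1/2)^j" if "n \<ge> N j" for n j
  proof -
    have "ennreal ((norm (abs_L2 f - X n))\<^sup>2) \<le> ennreal (((1/2)^j)\<^sup>2)"
      using le[OF that] norm_abs_L2_diff[OF f square_integrable_rep_L2[of "X n"]] by (simp add: abs_rep_L2)
    then have "(norm (abs_L2 f - X n))\<^sup>2 \<le> ((1/2)^j)\<^sup>2"
      by (subst (asm) ennreal_le_iff) auto
    then show ?thesis by (rule power2_le_imp_le) auto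
  qed
  have "X \<longlonglongrightarrow> abs_L2 f"
  proof (rule LIMSEQ_I)
    fix e :: real assume "e > 0"
    then obtain j where "(1/2)^j < e"
      using real_arch_pow_inv[of e "1/2"] by auto
    then show "\<exists>no. \<forall>n\<ge>no. norm (X n - abs_L2 f) < e"
      using lim[of j] by (intro exI[of _ "N j"]) (force simp: norm_minus_commute)
  qed
  then show ?thesis by (auto simp: convergent_def)
qed

instance L2 :: (finite, finite) banach
  by standard (rule L2_complete)

lemma L2_dominated_convergence:
  fixes f :: "real ^ 's \<Rightarrow> complex ^ 'm"
  assumes f: "square_integrable f"
    and s: "\<And>i. s i \<in> borel_measurable borel"
    and lim: "\<And>x. (\<lambda>i. s i x) \<longlonglongrightarrow> f x"
    and bound: "\<And>i x. norm (s i x) \<le> 2 * norm (f x)"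
  shows "square_integrable (s i)" "(\<lambda>i. abs_L2 (s i)) \<longlonglongrightarrow> abs_L2 f"
proof -
  note [measurable] = square_integrable_measurable[OF f] s
  have f2: "integrable lborel (\<lambda>x. (norm (f x))\<^sup>2)"
    using f by (simp add: square_integrable_def)
  have si: "square_integrable (s i)" for i
  proof -
    have "integrable lborel (\<lambda>x. (norm (s i x))\<^sup>2)"
    proof (rule Bochner_Integration.integrable_bound)
      show "integrable lborel (\<lambda>x. 4 * (norm (f x))\<^sup>2)"
        using f2 by simp
      show "AE x in lborel. norm ((norm (s i x))\<^sup>2) \<le> norm (4 * (norm (f x))\<^sup>2)"
      proof (intro AE_I2)
        fix x
        show "norm ((norm (s i x))\<^sup>2) \<le> norm (4 * (norm (f x))\<^sup>2)"
          using power_mono[OF bound[of i x], of 2] by (simp add: power_mult_distrib)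
      qed
    qed measurable
    then show ?thesis
      using s by (simp add: square_integrable_def)
  qed
  then show "square_integrable (s i)" .
  have "(\<lambda>i. LINT x|lborel. (norm (s i x - f x))\<^sup>2) \<longlonglongrightarrow> (LINT x|(lborel :: (real ^ 's) measure). (0::real))"
  proof (rule integral_dominated_convergence[where w = "\<lambda>x. 9 * (norm (f x))\<^sup>2"])
    show "AE x in lborel. (\<lambda>i. (norm (s i x - f x))\<^sup>2) \<longlonglongrightarrow> 0"
    proof (intro AE_I2)
      fix x
      have "(\<lambda>i. (norm (s i x - f x))\<^sup>2) \<longlonglongrightarrow> (norm (f x - f x))\<^sup>2"
        by (intro tendsto_intros lim)
      then show "(\<lambda>i. (norm (s i x - f x))\<^sup>2) \<longlonglongrightarrow> 0" by simp
    qed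
    show "AE x in lborel. norm ((norm (s i x - f x))\<^sup>2) \<le> 9 * (norm (f x))\<^sup>2" for i
    proof (intro AE_I2)
      fix x
      have "norm (s i x - f x) \<le> 3 * norm (f x)"
        using bound[of i x] norm_triangle_ineq4[of "s i x" "f x"] by linarith
      from power_mono[OF this, of 2]
      show "norm ((norm (s i x - f x))\<^sup>2) \<le> 9 * (norm (f x))\<^sup>2"
        by (simp add: power_mult_distrib)
    qed
  qed (use f2 in auto)
  moreover have "(LINT x|lborel. (norm (s i x - f x))\<^sup>2) = (norm (abs_L2 (s i) - abs_L2 f))\<^sup>2" for i
  proof -
    have "(norm (abs_L2 (s i) - abs_L2 f))\<^sup>2 = enn2real (ennreal ((norm (abs_L2 (s i) - abs_L2 f))\<^sup>2))"
      by simp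
    also have "\<dots> = (LINT x|lborel. (norm (s i x - f x))\<^sup>2)"
      unfolding norm_abs_L2_diff[OF si f]
      by (subst integral_eq_nn_integral) auto
    finally show ?thesis by simp
  qed
  ultimately have "(\<lambda>i. (norm (abs_L2 (s i) - abs_L2 f))\<^sup>2) \<longlonglongrightarrow> 0"
    by simp
  from tendsto_real_sqrt[OF this]
  have "(\<lambda>i. norm (abs_L2 (s i) - abs_L2 f)) \<longlonglongrightarrow> 0" by simp
  then show "(\<lambda>i. abs_L2 (s i)) \<longlonglongrightarrow> abs_L2 f"
    by (metis LIM_zero_cancel tendsto_norm_zero_iff)
qed

definition L2_ind :: "(real ^ 's) set \<Rightarrow> complex ^ 'm \<Rightarrow> ('s::finite, 'm::finite) L2" where
  "L2_ind S c = abs_L2 (\<lambda>x. indicat_real S x *\<^sub>R c)"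

lemma square_integrable_ind:
  assumes "S \<in> sets borel" "emeasure lborel S < \<infinity>"
  shows "square_integrable (\<lambda>x. indicat_real S x *\<^sub>R (c :: complex ^ 'm))"
proof -
  have "(\<lambda>x. (norm (indicat_real S x *\<^sub>R c))\<^sup>2) = (\<lambda>x. indicat_real S x * (norm c)\<^sup>2)"
    by (auto simp: indicator_def)
  then show ?thesis
    using assms by (simp add: square_integrable_def)
qed

lemma norm_L2_ind_diff:
  assumes "S \<in> sets borel" "emeasure lborel S < \<infinity>" "T \<in> sets borel" "T \<subseteq> S"
  shows "norm (L2_ind S c - L2_ind T c) = norm c * sqrt (measure lborel (S - T))"
proof -
  have fin: "emeasure lborel T < \<infinity>" "emeasure lborel (S - T) < \<infinity>"
    using assms emeasure_mono[of T S lborel] emeasure_mono[of "S - T" S lborel] by auto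
  have "ennreal ((norm (L2_ind S c - L2_ind T c))\<^sup>2) =
     (\<integral>\<^sup>+x. ennreal ((norm (indicat_real S x *\<^sub>R c - indicat_real T x *\<^sub>R c))\<^sup>2) \<partial>lborel)"
    unfolding L2_ind_def using assms fin by (intro norm_abs_L2_diff square_integrable_ind) auto
  also have "\<dots> = (\<integral>\<^sup>+x. ennreal ((norm c)\<^sup>2) * indicator (S - T) x \<partial>lborel)"
    using assms(4) by (intro nn_integral_cong) (auto simp: indicator_def)
  also have "\<dots> = ennreal ((norm c)\<^sup>2 * measure lborel (S - T))"
    using assms fin by (simp add: nn_integral_cmult_indicator emeasure_eq_ennreal_measure ennreal_mult'' less_top)
  finally have "(norm (L2_ind S c - L2_ind T c))\<^sup>2 = (norm c)\<^sup>2 * measure lborel (S - T)"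
    by (subst (asm) ennreal_inj) auto
  then have "sqrt ((norm (L2_ind S c - L2_ind T c))\<^sup>2) = sqrt ((norm c)\<^sup>2 * measure lborel (S - T))"
    by simp
  then show ?thesis by (simp add: real_sqrt_mult)
qed

lemma L2_separable: "\<exists>Q :: ('s::finite, 'm::finite) L2 set. countable Q \<and> closure Q = UNIV"
proof -
  obtain B :: "(real ^ 's) set set" where B: "countable B" "topological_basis B"
    using ex_countable_basis by blast
  obtain D :: "(complex ^ 'm) set" where D: "countable D" "UNIV \<subseteq> closure D"
    by (rule separable[of "UNIV :: (complex ^ 'm) set"])
  define SS where "SS = Union ` {F. finite F \<and> F \<subseteq> B}"
  have SS: "countable SS"
    unfolding SS_def using B(1) by (intro countable_image countable_Collect_finite_subset)
  define G where "G = (\<lambda>(S, c). L2_ind S c :: ('s, 'm) L2) ` (SS \<times> D)"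
  have G: "countable G" unfolding G_def using SS D(1) by auto
  define Q where "Q = sum_list ` lists G"
  have Q: "countable Q" unfolding Q_def using G by (intro countable_image countable_lists)
  have Q_add: "f + g \<in> Q" if "f \<in> Q" "g \<in> Q" for f g
  proof -
    obtain xs ys where "xs \<in> lists G" "f = sum_list xs" "ys \<in> lists G" "g = sum_list ys"
      using \<open>f \<in> Q\<close> \<open>g \<in> Q\<close> unfolding Q_def by (elim imageE)
    then show ?thesis unfolding Q_def by (intro image_eqI[of _ _ "xs @ ys"]) auto
  qed
  have Q0: "0 \<in> Q"
    unfolding Q_def by (rule image_eqI[of _ _ "[]"]) auto
  have GQ: "f \<in> Q" if "f \<in> G" for f
    unfolding Q_def using that by (intro image_eqI[of _ _ "[f]"]) auto
  define V where "V = closure Q"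
  have V_lim: "f \<in> V" if "\<And>i. s i \<in> V" "s \<longlonglongrightarrow> f" for s :: "nat \<Rightarrow> ('s, 'm) L2" and f
    using that unfolding V_def by (meson closed_closure closed_sequentially)
  have V0: "0 \<in> V" using Q0 closure_subset unfolding V_def by auto
  have V_add: "f + g \<in> V" if fg: "f \<in> V" "g \<in> V" for f g
  proof -
    obtain s t where "\<And>i. s i \<in> Q" "s \<longlonglongrightarrow> f" "\<And>i. t i \<in> Q" "t \<longlonglongrightarrow> g"
      using fg unfolding V_def closure_sequential by blast
    then show ?thesis unfolding V_def closure_sequential
      by (intro exI[of _ "\<lambda>i. s i + t i"]) (auto intro: Q_add tendsto_add)
  qed
  have SS_open: "open S" if "S \<in> SS" for S
    using that topological_basis_open[OF B(2)] by (auto simp: SS_def)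
  have V_SS: "L2_ind S c \<in> V" if S: "S \<in> SS" "emeasure lborel S < \<infinity>" for S and c :: "complex ^ 'm"
  proof -
    have si: "square_integrable (\<lambda>x. indicat_real S x *\<^sub>R c)" for c :: "complex ^ 'm"
      using SS_open[OF S(1)] S(2) by (intro square_integrable_ind) auto
    obtain d where d: "\<And>i. d i \<in> D" "d \<longlonglongrightarrow> c"
      using D(2) unfolding closure_sequential by (metis closure_sequential iso_tuple_UNIV_I subset_iff)
    have "L2_ind S (d i) \<in> V" for i
      using GQ[of "L2_ind S (d i)"] d(1) S(1) closure_subset unfolding V_def G_def by auto
    moreover have "(\<lambda>i. L2_ind S (d i)) \<longlonglongrightarrow> L2_ind S c"
    proof -
      have eq: "norm (L2_ind S (d i) - L2_ind S c) = norm (d i - c) * sqrt (measure lborel S)" for i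
      proof -
        have "ennreal ((norm (L2_ind S (d i) - L2_ind S c))\<^sup>2) =
          (\<integral>\<^sup>+x. ennreal ((norm (indicat_real S x *\<^sub>R d i - indicat_real S x *\<^sub>R c))\<^sup>2) \<partial>lborel)"
          unfolding L2_ind_def by (intro norm_abs_L2_diff si)
        also have "\<dots> = (\<integral>\<^sup>+x. ennreal ((norm (d i - c))\<^sup>2) * indicator S x \<partial>lborel)"
          by (intro nn_integral_cong) (auto simp: indicator_def)
        also have "\<dots> = ennreal ((norm (d i - c))\<^sup>2 * measure lborel S)"
          using S SS_open[OF S(1)] by (simp add: nn_integral_cmult_indicator emeasure_eq_ennreal_measure ennreal_mult'' less_top)
        finally have "(norm (L2_ind S (d i) - L2_ind S c))\<^sup>2 = (norm (d i - c))\<^sup>2 * measure lborel S"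
          by (subst (asm) ennreal_inj) auto
        then have "sqrt ((norm (L2_ind S (d i) - L2_ind S c))\<^sup>2) = sqrt ((norm (d i - c))\<^sup>2 * measure lborel S)"
          by simp
        then show ?thesis by (simp add: real_sqrt_mult)
      qed
      have "(\<lambda>i. norm (d i - c) * sqrt (measure lborel S)) \<longlonglongrightarrow> norm (c - c) * sqrt (measure lborel S)"
        by (intro tendsto_intros d(2))
      then show ?thesis
        unfolding eq[symmetric] by (simp add: LIM_zero_cancel tendsto_norm_zero_iff)
    qed
    ultimately show ?thesis by (rule V_lim)
  qed
  have V_open: "L2_ind U c \<in> V" if U: "open U" "emeasure lborel U < \<infinity>" for U and c :: "complex ^ 'm"
  proof -
    obtain B' where B': "B' \<subseteq> B" "\<Union>B' = U"
      using B(2) U(1) unfolding topological_basis_def by metis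
    show ?thesis
    proof (cases "B' = {}")
      case True
      then have "U = {}" using B' by auto
      then show ?thesis using V0 by (simp add: L2_ind_def zero_L2_def)
    next
      case False
      have cB': "countable B'" using B'(1) B(1) countable_subset by blast
      define S where "S n = \<Union>(from_nat_into B' ` {..<n})" for n
      have S_SS: "S n \<in> SS" for n
        unfolding S_def SS_def using from_nat_into[OF False] B'(1) by (intro imageI) auto
      have S_U: "S n \<subseteq> U" for n
        unfolding S_def using from_nat_into[OF False] B'(2) by auto
      have lim: "(\<lambda>n. indicat_real (S n) x *\<^sub>R c) \<longlonglongrightarrow> indicat_real U x *\<^sub>R c" for x
      proof (cases "x \<in> U")
        case True
        then obtain b where b: "b \<in> B'" "x \<in> b" using B'(2) by auto
        then obtain k where "from_nat_into B' k = b" using from_nat_into_surj[OF cB'] by auto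
        then have "x \<in> S n" if "n \<ge> Suc k" for n
          using that b unfolding S_def by (auto intro!: bexI[of _ k])
        then have "\<forall>\<^sub>F n in sequentially. indicat_real (S n) x *\<^sub>R c = indicat_real U x *\<^sub>R c"
          using True by (intro eventually_sequentiallyI[of "Suc k"]) (auto simp: indicator_def)
        then show ?thesis by (rule tendsto_eventually)
      next
        case False
        then have "x \<notin> S n" for n using S_U by auto
        then show ?thesis using False by simp
      qed
      have "(\<lambda>n. L2_ind (S n) c) \<longlonglongrightarrow> L2_ind U c"
        unfolding L2_ind_def
      proof (rule L2_dominated_convergence(2))
        show "square_integrable (\<lambda>x. indicat_real U x *\<^sub>R c)"
          using U by (intro square_integrable_ind) auto
        have [measurable]: "S n \<in> sets borel" for n using SS_open[OF S_SS] by auto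
        show "(\<lambda>x. indicat_real (S i) x *\<^sub>R c) \<in> borel_measurable borel" for i
          by measurable
        show "norm (indicat_real (S i) x *\<^sub>R c) \<le> 2 * norm (indicat_real U x *\<^sub>R c)" for i x
          using S_U[of i] by (auto simp: indicator_def)
      qed (rule lim)
      moreover have "L2_ind (S n) c \<in> V" for n
      proof (rule V_SS[OF S_SS])
        show "emeasure lborel (S n) < \<infinity>"
          using U emeasure_mono[OF S_U[of n], of lborel] by auto
      qed
      ultimately show ?thesis by (rule V_lim[rotated])
    qed
  qed
  have V_set: "L2_ind A c \<in> V" if A: "A \<in> sets borel" "emeasure lborel A < \<infinity>" for A and c :: "complex ^ 'm"
  proof -
    have "\<exists>U. open U \<and> A \<subseteq> U \<and> emeasure lborel (U - A) < ennreal (1 / real (Suc i))" for i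
    proof -
      have "A \<in> sets lebesgue" using A by auto
      then obtain U where U: "open U" "A \<subseteq> U" "emeasure lebesgue (U - A) < ennreal (1 / real (Suc i))"
        by (rule sets_lebesgue_outer_open[of _ "1 / real (Suc i)"]) auto
      moreover have "U - A \<in> sets borel" using A U by auto
      ultimately show ?thesis by auto
    qed
    then obtain U where U: "\<And>i. open (U i)" "\<And>i. A \<subseteq> U i"
      "\<And>i. emeasure lborel (U i - A) < ennreal (1 / real (Suc i))"
      by metis
    have fin: "emeasure lborel (U i) < \<infinity>" for i
    proof -
      have "emeasure lborel (U i) = emeasure lborel ((U i - A) \<union> A)"
        using U(2)[of i] by (simp add: Un_absorb2)
      also have "\<dots> \<le> emeasure lborel (U i - A) + emeasure lborel A"
        using A U(1)[of i] by (intro emeasure_subadditive) auto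
      also have "\<dots> < \<infinity>"
        using U(3)[of i] A(2) by (auto simp: ennreal_add_eq_top less_top[symmetric])
      finally show ?thesis .
    qed
    have "(\<lambda>i. L2_ind (U i) c) \<longlonglongrightarrow> L2_ind A c"
    proof -
      have le: "norm (L2_ind (U i) c - L2_ind A c) \<le> norm c * sqrt (1 / real (Suc i))" for i
      proof -
        have "measure lborel (U i - A) \<le> 1 / real (Suc i)"
          using U(3)[of i] unfolding measure_def
          by (metis enn2real_leI less_imp_le of_nat_0_le_iff zero_le_divide_1_iff)
        then show ?thesis
          using A U fin[of i] by (subst norm_L2_ind_diff) (auto intro!: mult_left_mono simp del: of_nat_Suc)
      qed
      have "(\<lambda>i. norm c * sqrt (1 / real (Suc i))) \<longlonglongrightarrow> norm c * sqrt 0"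
        by (intro tendsto_mult tendsto_const tendsto_real_sqrt LIMSEQ_Suc[OF lim_1_over_n])
      then have "(\<lambda>i. norm c * sqrt (1 / real (Suc i))) \<longlonglongrightarrow> 0"
        by (simp only: real_sqrt_zero mult_zero_right)
      then have "(\<lambda>i. L2_ind (U i) c - L2_ind A c) \<longlonglongrightarrow> 0"
        by (rule Lim_null_comparison[OF always_eventually[OF allI[OF le]]])
      then show ?thesis by (rule LIM_zero_cancel)
    qed
    then show ?thesis by (rule V_lim[OF V_open[OF U(1) fin]])
  qed
  have V_sum: "square_integrable (\<lambda>x. \<Sum>y\<in>Y. g y x) \<and> abs_L2 (\<lambda>x. \<Sum>y\<in>Y. g y x) \<in> V"
    if "finite Y" "\<And>y. y \<in> Y \<Longrightarrow> square_integrable (g y) \<and> abs_L2 (g y) \<in> V"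
    for Y :: "(complex ^ 'm) set" and g :: "complex ^ 'm \<Rightarrow> real ^ 's \<Rightarrow> complex ^ 'm"
    using that
  proof (induction Y)
    case empty
    then show ?case using V0 by (simp add: square_integrable_zero zero_L2_def)
  next
    case (insert y Y)
    have *: "abs_L2 (\<lambda>x. g y x + (\<Sum>y\<in>Y. g y x)) = abs_L2 (g y) + abs_L2 (\<lambda>x. \<Sum>y\<in>Y. g y x)"
      using insert by (simp add: plus_L2.abs_eq L2_eq_refl)
    show ?case
      using insert by (auto simp: * intro!: square_integrable_add V_add)
  qed
  have V_simple: "abs_L2 h \<in> V" if h: "simple_function lborel h" "square_integrable h"
    for h :: "real ^ 's \<Rightarrow> complex ^ 'm"
  proof -
    note [measurable] = square_integrable_measurable[OF h(2)]
    have finY: "finite (h ` UNIV)" using h(1) by (auto simp: simple_function_def)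
    have "h x = (\<Sum>y\<in>h ` UNIV. indicat_real (h -` {y}) x *\<^sub>R y)" for x
    proof -
      have "(\<Sum>y\<in>h ` UNIV. indicat_real (h -` {y}) x *\<^sub>R y) = (\<Sum>y\<in>h ` UNIV. if h x = y then y else 0)"
        by (intro sum.cong) (auto simp: indicator_def)
      then show ?thesis using finY by simp
    qed
    then have eq: "h = (\<lambda>x. \<Sum>y\<in>h ` UNIV. indicat_real (h -` {y}) x *\<^sub>R y)" by (rule ext)
    have "abs_L2 (\<lambda>x. \<Sum>y\<in>h ` UNIV. indicat_real (h -` {y}) x *\<^sub>R y) \<in> V"
    proof (rule V_sum[THEN conjunct2, OF finY])
      fix y assume "y \<in> h ` UNIV"
      show "square_integrable (\<lambda>x. indicat_real (h -` {y}) x *\<^sub>R y) \<and>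
            abs_L2 (\<lambda>x. indicat_real (h -` {y}) x *\<^sub>R y) \<in> V"
      proof (cases "y = 0")
        case True
        then show ?thesis using V0 by (simp add: square_integrable_zero zero_L2_def)
      next
        case False
        have meas: "h -` {y} \<in> sets borel"
          using measurable_sets[of h borel borel "{y}"] by simp
        have "(norm y)\<^sup>2 * emeasure lborel (h -` {y}) = (\<integral>\<^sup>+x. ennreal ((norm y)\<^sup>2) * indicator (h -` {y}) x \<partial>lborel)"
          using meas by (simp add: nn_integral_cmult_indicator)
        also have "\<dots> \<le> (\<integral>\<^sup>+x. ennreal ((norm (h x))\<^sup>2) \<partial>lborel)"
          by (intro nn_integral_mono) (auto simp: indicator_def)
        also have "\<dots> < \<infinity>"
          using h(2) by (simp add: square_integrable_def nn_integral_eq_integral)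
        finally have "emeasure lborel (h -` {y}) < \<infinity>"
          using False by (auto simp: ennreal_mult_less_top)
        then show ?thesis
          using V_set[OF meas, of y] square_integrable_ind[OF meas, of y] by (simp add: L2_ind_def)
      qed
    qed
    then show ?thesis by (simp only: eq[symmetric])
  qed
  have "f \<in> V" for f :: "('s, 'm) L2"
  proof -
    obtain s where s: "\<And>i. simple_function lborel (s i)"
      "\<And>x. (\<lambda>i. s i x) \<longlonglongrightarrow> rep_L2 f x" "\<And>i x. dist (s i x) 0 \<le> 2 * dist (rep_L2 f x) 0"
      using borel_measurable_implies_sequence_metric[of "rep_L2 f" lborel 0] by auto
    have "s i \<in> borel_measurable borel" for i
      using borel_measurable_simple_function[OF s(1)] by simp
    note * = L2_dominated_convergence[OF square_integrable_rep_L2 this s(2)]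
    have "abs_L2 (s i) \<in> V" for i
      using s by (intro V_simple *) (auto simp: dist_norm)
    moreover have "(\<lambda>i. abs_L2 (s i)) \<longlonglongrightarrow> f"
      using *(2) s(3) by (simp add: abs_rep_L2)
    ultimately show ?thesis by (rule V_lim)
  qed
  then show ?thesis using Q unfolding V_def by blast
qed

instance L2 :: (finite, finite) second_countable_topology
proof
  obtain Q :: "('a, 'b) L2 set" where Q: "countable Q" "closure Q = UNIV"
    using L2_separable by blast
  define K where "K = (\<lambda>(q, n). ball q (1 / real (Suc n))) ` (Q \<times> (UNIV :: nat set))"
  have "countable K" using Q(1) by (auto simp: K_def)
  moreover have "topological_basis K"
  proof (rule topological_basisI)
    fix S assume "S \<in> K" then show "open S" by (auto simp: K_def)
  next
    fix S :: "('a, 'b) L2 set" and x assume "open S" "x \<in> S"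
    then obtain e where e: "e > 0" "ball x e \<subseteq> S" by (auto simp: open_contains_ball)
    obtain n where n: "1 / real (Suc n) < e / 2"
      using e(1) by (metis half_gt_zero nat_approx_posE)
    obtain q where q: "q \<in> Q" "dist q x < 1 / real (Suc n)"
      using Q(2) closure_approachable[of x Q] by (metis UNIV_I divide_pos_pos of_nat_0_less_iff zero_less_Suc zero_less_one)
    have "ball q (1 / real (Suc n)) \<subseteq> ball x e"
    proof
      fix y assume "y \<in> ball q (1 / real (Suc n))"
      then show "y \<in> ball x e"
        using q(2) n dist_triangle[of x y q] by (auto simp: dist_commute simp del: of_nat_Suc)
    qed
    then show "\<exists>S'\<in>K. x \<in> S' \<and> S' \<subseteq> S"
      using q e(2) by (intro bexI[of _ "ball q (1 / real (Suc n))"]) (auto simp: K_def)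
  qed
  ultimately show "\<exists>B :: ('a, 'b) L2 set set. countable B \<and> open = generate_topology B"
    using topological_basis_imp_subbasis by blast
qed

lemma integrable_hermitian:
  fixes f g :: "real ^ 's \<Rightarrow> complex ^ 'm"
  assumes "square_integrable f" "square_integrable g"
  shows "integrable lborel (\<lambda>x. \<Sum>i\<in>UNIV. f x $ i * cnj (g x $ i))"
proof (rule Bochner_Integration.integrable_bound)
  show "integrable lborel (\<lambda>x. real CARD('m) * ((norm (f x))\<^sup>2 + (norm (g x))\<^sup>2))"
    using assms by (auto simp: square_integrable_def)
  show "(\<lambda>x. \<Sum>i\<in>UNIV. f x $ i * cnj (g x $ i)) \<in> borel_measurable lborel"
    using assms by (simp add: measurable_hermitian square_integrable_measurable)
  have "cmod (\<Sum>i\<in>UNIV. f x $ i * cnj (g x $ i)) \<le> real CARD('m) * ((norm (f x))\<^sup>2 + (norm (g x))\<^sup>2)" for x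
  proof -
    have "cmod (f x $ i * cnj (g x $ i)) \<le> (norm (f x))\<^sup>2 + (norm (g x))\<^sup>2" for i
    proof -
      have "cmod (f x $ i * cnj (g x $ i)) \<le> norm (f x) * norm (g x)"
        by (auto simp: norm_mult intro!: mult_mono Finite_Cartesian_Product.norm_nth_le)
      also have "\<dots> \<le> (norm (f x))\<^sup>2 + (norm (g x))\<^sup>2"
        using sum_squares_bound[of "norm (f x)" "norm (g x)"]
          mult_nonneg_nonneg[OF norm_ge_zero[of "f x"] norm_ge_zero[of "g x"]] by linarith
      finally show ?thesis .
    qed
    from sum_norm_bound[of UNIV "\<lambda>i. f x $ i * cnj (g x $ i)", OF this]
    show ?thesis by simp
  qed
  then show "AE x in lborel. norm (\<Sum>i\<in>UNIV. f x $ i * cnj (g x $ i))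
      \<le> norm (real CARD('m) * ((norm (f x))\<^sup>2 + (norm (g x))\<^sup>2))"
    by (auto intro: order_trans[OF _ abs_ge_self])
qed

lemma Re_cinner: "Re (cinner f g) = f \<bullet> g"
proof transfer
  fix f g :: "real ^ 's \<Rightarrow> complex ^ 'm"
  assume "L2_eq f f" "L2_eq g g"
  then have "integrable lborel (\<lambda>x. \<Sum>i\<in>UNIV. f x $ i * cnj (g x $ i))"
    by (intro integrable_hermitian) (auto simp: L2_eq_refl)
  then show "Re (LINT x|lborel. (\<Sum>i\<in>UNIV. f x $ i * cnj (g x $ i))) = (LINT x|lborel. f x \<bullet> g x)"
    by (subst integral_Re[symmetric]) (auto simp: inner_vec_def inner_complex_def)
qed

lemma cinner_self: "cinner f f = complex_of_real ((norm f)\<^sup>2)"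
proof (rule complex_eqI)
  show "Re (cinner f f) = Re (complex_of_real ((norm f)\<^sup>2))"
    by (simp add: Re_cinner power2_norm_eq_inner)
  show "Im (cinner f f) = Im (complex_of_real ((norm f)\<^sup>2))"
  proof (simp, transfer)
    fix f :: "real ^ 's \<Rightarrow> complex ^ 'm"
    assume "L2_eq f f"
    then have "integrable lborel (\<lambda>x. \<Sum>i\<in>UNIV. f x $ i * cnj (f x $ i))"
      by (intro integrable_hermitian) (auto simp: L2_eq_refl)
    then show "Im (LINT x|lborel. (\<Sum>i\<in>UNIV. f x $ i * cnj (f x $ i))) = 0"
      by (subst integral_Im[symmetric]) (auto simp: complex_mult_cnj)
  qed
qed

definition bounded_clinear :: "(('s::finite, 'm::finite) L2 \<Rightarrow> ('s, 'n::finite) L2) \<Rightarrow> bool" where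
  "bounded_clinear T \<longleftrightarrow> bounded_linear T \<and> (\<forall>c f. T (scaleC c f) = scaleC c (T f))"

text \<open>
  Possibly unbounded operators are represented by their graphs; the domain is then the
  \<^const>\<open>Domain\<close> of the relation.
\<close>

type_synonym ('s, 'm, 'n) op = "(('s, 'm) L2 \<times> ('s, 'n) L2) set"

definition op_graph :: "(('s::finite, 'm::finite) L2 \<Rightarrow> ('s, 'n::finite) L2) \<Rightarrow> ('s, 'm, 'n) op" where
  "op_graph T = {(f, g). g = T f}"

definition densely_defined :: "('s::finite, 'm::finite, 'n::finite) op \<Rightarrow> bool" where
  "densely_defined G \<longleftrightarrow> closure (Domain G) = UNIV"

definition cadjoint :: "('s::finite, 'm::finite, 'n::finite) op \<Rightarrow> ('s, 'n, 'm) op" where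
  "cadjoint G = {(g, g'). \<forall>(f, f')\<in>G. cinner f' g = cinner f g'}"

definition op_uminus :: "('s::finite, 'm::finite, 'n::finite) op \<Rightarrow> ('s, 'm, 'n) op" where
  "op_uminus G = {(f, - f') | f f'. (f, f') \<in> G}"

definition op_nonneg :: "('s::finite, 'm::finite, 'm) op \<Rightarrow> bool" where
  "op_nonneg G \<longleftrightarrow>
     densely_defined G \<and> cadjoint G = G \<and> (\<forall>(f, f')\<in>G. cinner f' f \<in> \<real>\<^sub>\<ge>\<^sub>0)"

definition op_nonpos :: "('s::finite, 'm::finite, 'm) op \<Rightarrow> bool" where
  "op_nonpos G \<longleftrightarrow> op_nonneg (op_uminus G)"

definition translation_invariant :: "('s::finite, 'm::finite, 'n::finite) op \<Rightarrow> bool" where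
  "translation_invariant G \<longleftrightarrow> (\<forall>h. \<forall>(f, f')\<in>G. (translate h f, translate h f') \<in> G)"

text \<open>
  The Fourier--Plancherel transform as the $L_2$ limit of truncated Fourier integrals.  By
  Plancherel's theorem every truncated integral is square-integrable and the limit exists.
\<close>

definition fourier :: "('s::finite, 'm::finite) L2 \<Rightarrow> ('s, 'm) L2" where
  "fourier f = lim (\<lambda>k. abs_L2 (\<lambda>\<omega>. ((2 * pi) powr (- real CARD('s) / 2)) *\<^sub>R
     (LINT x:cball 0 (real k)|lborel. cis (- (\<omega> \<bullet> x)) *s rep_L2 f x)))"

definition multiplication_op ::
    "(real ^ 's \<Rightarrow> complex ^ 'm ^ 'n) \<Rightarrow> ('s::finite, 'm::finite, 'n::finite) op" where
  "multiplication_op M = {(f, g). AE \<omega> in lborel. rep_L2 g \<omega> = M \<omega> *v rep_L2 f \<omega>}"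

text \<open>
  The graph of the conjugate of \<open>G\<close> by the (unitary) Fourier transform is the image of the graph of
  \<open>G\<close> under the transform in both components.
\<close>

definition has_continuous_symbol :: "('s::finite, 'm::finite, 'n::finite) op \<Rightarrow> bool" where
  "has_continuous_symbol G \<longleftrightarrow>
     (\<exists>M. continuous_on UNIV M \<and> {(fourier f, fourier g) | f g. (f, g) \<in> G} = multiplication_op M)"

text \<open>Only the values at times \<open>t \<ge> 0\<close> of a semigroup are constrained and used.\<close>

definition C0_semigroup :: "(real \<Rightarrow> ('s::finite, 'n::finite) L2 \<Rightarrow> ('s, 'n) L2) \<Rightarrow> bool" where
  "C0_semigroup T \<longleftrightarrow>
     (\<forall>t\<ge>0. bounded_clinear (T t)) \<and> (\<forall>z. T 0 z = z) \<and>
     (\<forall>s\<ge>0. \<forall>t\<ge>0. \<forall>z. T (s + t) z = T s (T t z)) \<and>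
     (\<forall>z. ((\<lambda>t. T t z) \<longlongrightarrow> z) (at_right 0))"

definition generator ::
    "(real \<Rightarrow> ('s::finite, 'n::finite) L2 \<Rightarrow> ('s, 'n) L2) \<Rightarrow> ('s, 'n, 'n) op" where
  "generator T = {(z, w). ((\<lambda>h. (T h z - z) /\<^sub>R h) \<longlongrightarrow> w) (at_right 0)}"

text \<open>
  The operator exponential of a generator.  A $C_0$-semigroup is determined on \<open>t \<ge> 0\<close> by its
  generator, so the choice is immaterial.
\<close>

definition op_exp ::
    "('s::finite, 'n::finite, 'n) op \<Rightarrow> real \<Rightarrow> ('s, 'n) L2 \<Rightarrow> ('s, 'n) L2" where
  "op_exp A = (SOME T. C0_semigroup T \<and> generator T = A)"

definition ltsi_system ::
    "('s::finite, 'n::finite, 'n) op \<Rightarrow> (('s, 'm::finite) L2 \<Rightarrow> ('s, 'n) L2) \<Rightarrow>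
     (('s, 'n) L2 \<Rightarrow> ('s, 'p::finite) L2) \<Rightarrow> bool" where
  "ltsi_system A B C \<longleftrightarrow>
     densely_defined A \<and> (\<exists>T. C0_semigroup T \<and> generator T = A) \<and>
     bounded_clinear B \<and> bounded_clinear C \<and>
     translation_invariant A \<and> translation_invariant (op_graph B) \<and>
     translation_invariant (op_graph C) \<and>
     has_continuous_symbol A \<and> has_continuous_symbol (op_graph B) \<and>
     has_continuous_symbol (op_graph C)"

definition internally_relaxation ::
    "('s::finite, 'n::finite, 'n) op \<Rightarrow> (('s, 'm::finite) L2 \<Rightarrow> ('s, 'n) L2) \<Rightarrow>
     (('s, 'n) L2 \<Rightarrow> ('s, 'm) L2) \<Rightarrow> bool" where
  "internally_relaxation A B C \<longleftrightarrow> op_nonpos A \<and> op_graph B = cadjoint (op_graph C)"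

definition rest_integrable ::
    "('s::finite, 'n::finite, 'n) op \<Rightarrow> (('s, 'm::finite) L2 \<Rightarrow> ('s, 'n) L2) \<Rightarrow>
     (real \<Rightarrow> ('s, 'm) L2) \<Rightarrow> bool" where
  "rest_integrable A B u \<longleftrightarrow>
     (\<forall>t. set_integrable lebesgue {..t} (\<lambda>\<tau>. op_exp A (t - \<tau>) (B (u \<tau>))))"

definition rest_state ::
    "('s::finite, 'n::finite, 'n) op \<Rightarrow> (('s, 'm::finite) L2 \<Rightarrow> ('s, 'n) L2) \<Rightarrow>
     (real \<Rightarrow> ('s, 'm) L2) \<Rightarrow> real \<Rightarrow> ('s, 'n) L2" where
  "rest_state A B u t = (LINT \<tau>:{..t}|lebesgue. op_exp A (t - \<tau>) (B (u \<tau>)))"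

definition mild_state ::
    "('s::finite, 'n::finite, 'n) op \<Rightarrow> (('s, 'm::finite) L2 \<Rightarrow> ('s, 'n) L2) \<Rightarrow>
     ('s, 'n) L2 \<Rightarrow> (real \<Rightarrow> ('s, 'm) L2) \<Rightarrow> real \<Rightarrow> ('s, 'n) L2" where
  "mild_state A B z0 u t =
     op_exp A t z0 + (LINT \<tau>:{0..t}|lebesgue. op_exp A (t - \<tau>) (B (u \<tau>)))"

definition L2_input :: "real \<Rightarrow> (real \<Rightarrow> ('s::finite, 'm::finite) L2) \<Rightarrow> bool" where
  "L2_input t u \<longleftrightarrow>
     set_borel_measurable lebesgue {0..t} u \<and>
     set_integrable lebesgue {0..t} (\<lambda>\<tau>. (norm (u \<tau>))\<^sup>2)"

text \<open>The supply rate below is real-valued; \<^const>\<open>Re\<close> only serves to compare it in the reals.\<close>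

definition impedance_passive_with ::
    "('s::finite, 'n::finite, 'n) op \<Rightarrow> (('s, 'm::finite) L2 \<Rightarrow> ('s, 'n) L2) \<Rightarrow>
     (('s, 'n) L2 \<Rightarrow> ('s, 'm) L2) \<Rightarrow> (('s, 'n) L2 \<Rightarrow> real) \<Rightarrow> bool" where
  "impedance_passive_with A B C S \<longleftrightarrow>
     (\<exists>Q. bounded_clinear Q \<and> op_nonneg (op_graph Q) \<and>
          (\<forall>z. complex_of_real (S z) = cinner (Q z) z)) \<and>
     (\<forall>z0 t u. 0 \<le> t \<longrightarrow> L2_input t u \<longrightarrow>
        (let z = mild_state A B z0 u; y = (\<lambda>\<tau>. C (z \<tau>))
         in S (z t) \<le> S z0 +
              Re (LINT \<tau>:{0..t}|lebesgue. cinner (u \<tau>) (y \<tau>) + cinner (y \<tau>) (u \<tau>))))"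

end

theory Submission
  imports Defs
begin

text \<open>
  Write \<open>T t\<close> for the semigroup generated by \<open>A\<close>.  Two properties of \<open>T\<close> carry both claims.  Since \<open>A\<close> is
  dissipative, \<open>T t\<close> is a contraction; since \<open>A\<close> is self-adjoint, so is \<open>T t\<close>.  Each follows by
  differentiating along orbits that start in the dense domain of \<open>A\<close> (lemmas \<open>contraction\<close> and
  \<open>symmetric\<close>).  Two-sided differentiability of these orbits rests on a local uniform bound for \<open>T\<close>, which
  comes from Baire's theorem.

  Formally, passivity is \<open>d/dt \<parallel>z\<parallel>\<^sup>2 = 2 Re \<langle>A z, z\<rangle> + 2 Re \<langle>B u, z\<rangle> \<le> 2 Re \<langle>u, C z\<rangle>\<close>,
  but a mild solution with \<open>L2\<close> input need not be differentiable.  The argument therefore works with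
  increments.  If \<open>w\<close> is the contribution of the input between \<open>s\<close> and \<open>t\<close>, contractivity gives
  \<open>\<parallel>z t - w\<parallel> \<le> \<parallel>z s\<parallel>\<close>, hence \<open>\<parallel>z t\<parallel>\<^sup>2 - \<parallel>z s\<parallel>\<^sup>2 \<le> 2 Re \<langle>w, z t\<rangle>\<close>
  (lemma \<open>energy_increment\<close>).  By symmetry the right-hand side is the integral of
  \<open>2 Re \<langle>B (u \<tau>), T (t - \<tau>) (z t)\<rangle>\<close>, and \<open>T (t - \<tau>) (z t)\<close> is uniformly close to \<open>z \<tau>\<close> when \<open>t - s\<close> is
  small.  Summation over a fine partition yields the dissipation inequality (lemma \<open>energy_inequality\<close>).

  The energy identity uses self-adjointness once more: for \<open>t \<ge> 0\<close>,
  \<open>\<langle>u (-t), C (z t)\<rangle> = \<langle>B (u (-t)), T t (z 0)\<rangle> = \<langle>T t (B (u (-t))), z 0\<rangle>\<close>, and the integral of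
  \<open>T t (B (u (-t)))\<close> over \<open>t \<ge> 0\<close> is \<open>z 0\<close> itself.

  The semigroup theory is developed for real Hilbert spaces.  It applies to \<open>L2\<close> because the real part of
  the complex inner product is the real one, and it extends to the complex inner product because \<open>T t\<close>
  is complex linear.
\<close>

section \<open>Strongly continuous semigroups on Banach spaces\<close>
locale strongly_continuous_semigroup =
  fixes T :: "real \<Rightarrow> 'a::banach \<Rightarrow> 'a"
  assumes bounded_linear_at: "0 \<le> t \<Longrightarrow> bounded_linear (T t)"
    and at_zero: "T 0 x = x"
    and semigroup: "0 \<le> s \<Longrightarrow> 0 \<le> t \<Longrightarrow> T (s + t) x = T s (T t x)"
    and right_continuous_at_zero: "((\<lambda>t. T t x) \<longlongrightarrow> x) (at_right 0)"
begin

lemma linearity: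
  assumes "0 \<le> t"
  shows "T t 0 = 0" "T t (x + y) = T t x + T t y" "T t (x - y) = T t x - T t y"
    "T t (- x) = - T t x" "T t (r *\<^sub>R x) = r *\<^sub>R T t x"
  using linear_simps[OF bounded_linear_at[OF assms]] by auto

lemma continuous_orbit_at_zero: "continuous (at 0 within {0..}) (\<lambda>t. T t x)"
  using right_continuous_at_zero[of x] by (simp add: continuous_within at_within_Ici_at_right at_zero)

text \<open>
  Every orbit is bounded on some interval starting at \<open>0\<close>, whose length depends on the orbit.  Hence the
  closed sets \<open>F n\<close> below cover the space, and by Baire's theorem one of them contains a ball; linearity
  turns the bound on that ball into a bound on operator norms.
\<close>
lemma uniformly_bounded_near_zero:
  obtains \<delta> K where "0 < \<delta>" "\<And>t x. 0 \<le> t \<Longrightarrow> t \<le> \<delta> \<Longrightarrow> norm (T t x) \<le> K * norm x"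
proof -
  define F where "F n = (\<Inter>t\<in>{0..1 / real (Suc n)}. {x. norm (T t x) \<le> real n})" for n
  have closed_F: "closed (F n)" for n
    unfolding F_def
    by (intro closed_INT ballI closed_Collect_le continuous_intros
        linear_continuous_on bounded_linear_at) auto
  have "x \<in> (\<Union>n. F n)" for x
  proof -
    have "((\<lambda>t. T t x) \<longlongrightarrow> x) (at 0 within {0..})"
      using continuous_orbit_at_zero[of x] by (simp add: continuous_within at_zero)
    then obtain d where d: "0 < d" "\<And>t. 0 \<le> t \<Longrightarrow> t \<noteq> 0 \<Longrightarrow> t < d \<Longrightarrow> norm (T t x - x) < 1"
      unfolding Lim_within dist_norm by (metis abs_of_nonneg atLeast_iff diff_zero real_norm_def zero_less_abs_iff zero_less_one)
    obtain n :: nat where n: "max (1 / d) (norm x + 1) < real n"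
      using reals_Archimedean2[of "max (1 / d) (norm x + 1)"] by blast
    have "norm (T t x) \<le> real n" if "0 \<le> t" "t \<le> 1 / real (Suc n)" for t
    proof (cases "t = 0")
      case True
      then show ?thesis using n by (simp add: at_zero)
    next
      case False
      have "1 < d * real (Suc n)"
        using n d(1) by (simp add: field_simps)
      then have "1 / real (Suc n) < d"
        by (simp add: field_simps)
      with d(2)[OF that(1) False] that have "norm (T t x - x) < 1" by linarith
      then show ?thesis
        using n norm_triangle_sub[of "T t x" x] by linarith
    qed
    then have "x \<in> F n" by (simp add: F_def)
    then show ?thesis by blast
  qed
  then have "(\<Union>n. F n) = UNIV" by blast
  then have "\<exists>n. interior (F n) \<noteq> {}"
    using Baire_category_alt[of "euclidean :: 'a topology" "range F"] closed_F
    by (force simp: completely_metrizable_space_euclidean)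
  then obtain n y where "y \<in> interior (F n)" by blast
  then obtain r where r: "0 < r" "cball y r \<subseteq> F n"
    by (auto simp: mem_interior_cball)
  show thesis
  proof (rule that)
    show "0 < 1 / real (Suc n)" by simp
    fix t :: real and x assume t: "0 \<le> t" "t \<le> 1 / real (Suc n)"
    show "norm (T t x) \<le> (2 * real n / r) * norm x"
    proof (cases "x = 0")
      case False
      \<comment> \<open>Rescaled to norm \<open>r\<close>, so that \<open>y + v\<close> stays in the ball.\<close>
    define v where "v = (r / norm x) *\<^sub>R x"
      have "y + v \<in> F n" "y \<in> F n"
        using r False by (auto simp: v_def dist_norm intro!: subsetD[OF r(2)])
      with t have le: "norm (T t (y + v)) \<le> n" "norm (T t y) \<le> n"
        by (auto simp: F_def)
      have "norm (T t v) = norm (T t (y + v) - T t y)"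
        using t by (simp add: linearity)
      then have "norm (T t v) \<le> 2 * real n"
        using le norm_triangle_ineq4[of "T t (y + v)" "T t y"] by linarith
      moreover have "norm (T t v) = r / norm x * norm (T t x)"
        using t r(1) by (simp add: v_def linearity)
      ultimately show ?thesis
        using r(1) False by (simp add: field_simps)
    qed (use t in \<open>simp add: linearity\<close>)
  qed
qed

text \<open>
  A step of length at most \<open>\<delta>\<close> costs a factor \<open>L\<close>, so \<open>n + 1\<close> steps cost \<open>L ^ (n + 1)\<close>.
\<close>
lemma uniformly_bounded_on_intervals:
  obtains K where "0 \<le> K" "\<And>t x. 0 \<le> t \<Longrightarrow> t \<le> a \<Longrightarrow> norm (T t x) \<le> K * norm x"
proof -
  obtain \<delta> K where \<delta>: "0 < \<delta>" "\<And>t x. 0 \<le> t \<Longrightarrow> t \<le> \<delta> \<Longrightarrow> norm (T t x) \<le> K * norm x"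
    using uniformly_bounded_near_zero by blast
  define L where "L = max 1 K"
  have step: "norm (T t x) \<le> L * norm x" if "0 \<le> t" "t \<le> \<delta>" for t x
    using \<delta>(2)[OF that, of x] mult_right_mono[of K L "norm x"] by (simp add: L_def)
  have "norm (T t x) \<le> L ^ Suc n * norm x" if "0 \<le> t" "t \<le> real (Suc n) * \<delta>" for n t x
    using that
  proof (induction n arbitrary: t)
    case 0
    then show ?case using step by simp
  next
    case (Suc n)
    \<comment> \<open>One step of length at most \<open>\<delta>\<close> leads from \<open>s\<close> to \<open>t\<close>; the maximum covers the case that \<open>t\<close> itself is small.\<close>
    define s where "s = max 0 (t - \<delta>)"
    have s: "0 \<le> s" "s \<le> real (Suc n) * \<delta>" "0 \<le> t - s" "t - s \<le> \<delta>"
      using Suc.prems \<delta>(1) by (auto simp: s_def algebra_simps)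
    have "norm (T t x) = norm (T (t - s) (T s x))"
      using semigroup[of "t - s" s x] s by simp
    also have "\<dots> \<le> L * norm (T s x)" using step s by blast
    also have "\<dots> \<le> L * (L ^ Suc n * norm x)"
      using Suc.IH[of s] s by (intro mult_left_mono) (auto simp: L_def)
    finally show ?case by simp
  qed
  moreover obtain n where "a / \<delta> < real n" using reals_Archimedean2 by blast
  then have "a \<le> real (Suc n) * \<delta>" using \<delta>(1) by (simp add: field_simps)
  ultimately show thesis
    by (intro that[of "L ^ Suc n"]) (auto simp: L_def intro: order_trans)
qed

text \<open>
  Continuity from the right is the semigroup law.  From the left,
  \<open>T (t - h) x - T t x = T (t - h) (x - T h x)\<close>, and the uniform bound on \<open>T (t - h)\<close> enters.
\<close>
lemma orbit_tendsto:
  assumes r: "(r \<longlongrightarrow> t) F" and nonneg: "\<forall>\<^sub>F i in F. 0 \<le> r i" "0 \<le> t"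
  shows "((\<lambda>i. T (r i) x) \<longlongrightarrow> T t x) F"
proof -
  obtain K where K: "0 \<le> K" "\<And>s x. 0 \<le> s \<Longrightarrow> s \<le> t + 1 \<Longrightarrow> norm (T s x) \<le> K * norm x"
    using uniformly_bounded_on_intervals by blast
  have "((\<lambda>i. \<bar>r i - t\<bar>) \<longlongrightarrow> 0) F"
    using tendsto_rabs[OF tendsto_diff[OF r tendsto_const[of t]]] by simp
  from continuous_within_tendsto_compose[OF continuous_orbit_at_zero[of x] _ this]
  have "((\<lambda>i. T \<bar>r i - t\<bar> x) \<longlongrightarrow> x) F"
    by (simp add: at_zero)
  then have "((\<lambda>i. K * norm (T \<bar>r i - t\<bar> x - x)) \<longlongrightarrow> K * norm (x - x)) F"
    by (intro tendsto_intros)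
  then have lim: "((\<lambda>i. K * norm (T \<bar>r i - t\<bar> x - x)) \<longlongrightarrow> 0) F"
    by simp
  have near: "\<forall>\<^sub>F i in F. r i < t + 1"
    by (rule order_tendstoD(2)[OF r]) simp
  have "\<forall>\<^sub>F i in F. norm (T (r i) x - T t x) \<le> K * norm (T \<bar>r i - t\<bar> x - x)"
    using nonneg(1) near
  proof eventually_elim
    case (elim i)
    have "norm (T (r i) x - T t x) = norm (T (min (r i) t) (T \<bar>r i - t\<bar> x - x))"
    proof (cases "r i \<le> t")
      case True
      then show ?thesis
        using semigroup[of "r i" "t - r i" x] elim by (simp add: linearity norm_minus_commute)
    next
      case False
      then show ?thesis
        using semigroup[of t "r i - t" x] nonneg(2) by (simp add: linearity)
    qed
    also have "\<dots> \<le> K * norm (T \<bar>r i - t\<bar> x - x)"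
      using elim nonneg(2) by (intro K) auto
    finally show ?case .
  qed
  from Lim_null_comparison[OF this lim] show ?thesis by (rule LIM_zero_cancel)
qed

text \<open>
  Time and state may vary together; this is the form in which strong continuity is used from here on,
  both for limits of difference quotients and for the measurability of convolutions.
\<close>
lemma joint_tendsto:
  assumes r: "(r \<longlongrightarrow> t) F" and f: "(f \<longlongrightarrow> y) F" and nonneg: "\<forall>\<^sub>F i in F. 0 \<le> r i" "0 \<le> t"
  shows "((\<lambda>i. T (r i) (f i)) \<longlongrightarrow> T t y) F"
proof -
  obtain K where K: "0 \<le> K" "\<And>s x. 0 \<le> s \<Longrightarrow> s \<le> t + 1 \<Longrightarrow> norm (T s x) \<le> K * norm x"
    using uniformly_bounded_on_intervals by blast
  have near: "\<forall>\<^sub>F i in F. r i < t + 1"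
    by (rule order_tendstoD(2)[OF r]) simp
  have "\<forall>\<^sub>F i in F. norm (T (r i) (f i) - T (r i) y) \<le> K * norm (f i - y)"
    using nonneg(1) near
  proof eventually_elim
    case (elim i)
    then show ?case using K(2)[of "r i" "f i - y"] by (simp add: linearity)
  qed
  moreover have "((\<lambda>i. K * norm (f i - y)) \<longlongrightarrow> 0) F"
    using tendsto_mult[OF tendsto_const[of K] tendsto_norm[OF LIM_zero[OF f]]] by simp
  ultimately have "((\<lambda>i. T (r i) (f i) - T (r i) y) \<longlongrightarrow> 0) F"
    by (rule Lim_null_comparison)
  from tendsto_add[OF this orbit_tendsto[OF r nonneg, of y]] show ?thesis by simp
qed

lemma continuous_on_joint [continuous_intros]:
  assumes "continuous_on S r" "continuous_on S f" "\<And>x. x \<in> S \<Longrightarrow> 0 \<le> r x"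
  shows "continuous_on S (\<lambda>x. T (r x) (f x))"
  using assms unfolding continuous_on_def
  by (auto intro!: joint_tendsto simp: eventually_at_filter)

definition infinitesimal_generator :: "('a \<times> 'a) set" where
  "infinitesimal_generator = {(x, w). ((\<lambda>h. (T h x - x) /\<^sub>R h) \<longlongrightarrow> w) (at_right 0)}"

lemma generator_invariant:
  assumes xw: "(x, w) \<in> infinitesimal_generator" and t: "0 \<le> t"
  shows "(T t x, T t w) \<in> infinitesimal_generator"
proof -
  have "((\<lambda>h. T t ((T h x - x) /\<^sub>R h)) \<longlongrightarrow> T t w) (at_right 0)"
    using xw t by (intro joint_tendsto) (auto simp: infinitesimal_generator_def)
  moreover have "\<forall>\<^sub>F h in at_right 0. T t ((T h x - x) /\<^sub>R h) = (T h (T t x) - T t x) /\<^sub>R h"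
    using eventually_at_right_less[of 0]
  proof eventually_elim
    case (elim h)
    then have "T t (T h x) = T h (T t x)"
      using t semigroup[of t h x] semigroup[of h t x] by (simp add: add.commute)
    then show ?case using t by (simp add: linearity)
  qed
  ultimately show ?thesis
    unfolding infinitesimal_generator_def by (auto elim: Lim_transform_eventually)
qed

text \<open>
  The difference quotient between \<open>s\<close> and \<open>t\<close> is \<open>T (min s t)\<close> applied to the difference quotient
  \<open>D \<bar>s - t\<bar>\<close> at the origin.  This treats both sides of \<open>t\<close> at once and reduces the claim to joint
  continuity.
\<close>
lemma orbit_has_vector_derivative:
  assumes xw: "(x, w) \<in> infinitesimal_generator" and t: "0 \<le> t"
  shows "((\<lambda>s. T s x) has_vector_derivative T t w) (at t within {0..})"
proof -
  define D where "D h = (T h x - x) /\<^sub>R h" for h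
  have "(D \<longlongrightarrow> w) (at_right 0)"
    using xw by (simp add: infinitesimal_generator_def D_def[abs_def])
  moreover have "filterlim (\<lambda>s. \<bar>s - t\<bar>) (at_right 0) (at t within {0..})"
    unfolding filterlim_at
  proof
    show "\<forall>\<^sub>F s in at t within {0..}. \<bar>s - t\<bar> \<in> {0<..} \<and> \<bar>s - t\<bar> \<noteq> 0"
      by (simp add: eventually_at_filter)
    have "((\<lambda>s. \<bar>s - t\<bar>) \<longlongrightarrow> \<bar>t - t\<bar>) (at t within {0..})"
      by (intro tendsto_intros)
    then show "((\<lambda>s. \<bar>s - t\<bar>) \<longlongrightarrow> 0) (at t within {0..})" by simp
  qed
  ultimately have D: "((\<lambda>s. D \<bar>s - t\<bar>) \<longlongrightarrow> w) (at t within {0..})"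
    by (rule filterlim_compose)
  have "((\<lambda>s. min s t) \<longlongrightarrow> min t t) (at t within {0..})"
    by (intro tendsto_intros)
  then have "((\<lambda>s. T (min s t) (D \<bar>s - t\<bar>)) \<longlongrightarrow> T t w) (at t within {0..})"
    using t D by (intro joint_tendsto) (auto simp: eventually_at_filter)
  moreover have "\<forall>\<^sub>F s in at t within {0..}. T (min s t) (D \<bar>s - t\<bar>) = (T s x - T t x) /\<^sub>R (s - t)"
    unfolding eventually_at_filter
  proof (intro always_eventually allI impI)
    fix s assume s: "s \<noteq> t" "s \<in> {0..}"
    show "T (min s t) (D \<bar>s - t\<bar>) = (T s x - T t x) /\<^sub>R (s - t)"
    proof (cases "s < t")
      case True
      have "T (min s t) (D \<bar>s - t\<bar>) = (T t x - T s x) /\<^sub>R (t - s)"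
        using True s semigroup[of s "t - s" x] by (simp add: D_def linearity)
      also have "\<dots> = (T s x - T t x) /\<^sub>R (s - t)"
        using scaleR_minus_left[of "inverse (s - t)" "T t x - T s x"] True
        by (metis inverse_minus_eq minus_diff_eq scaleR_minus_left scaleR_minus_right)
      finally show ?thesis .
    next
      case False
      then show ?thesis
        using s t semigroup[of t "s - t" x] by (simp add: D_def linearity)
    qed
  qed
  ultimately have "((\<lambda>s. (T s x - T t x) /\<^sub>R (s - t)) \<longlongrightarrow> T t w) (at t within {0..})"
    by (rule Lim_transform_eventually)
  then have "((\<lambda>s. norm ((T s x - T t x) /\<^sub>R (s - t) - T t w)) \<longlongrightarrow> 0) (at t within {0..})"
    by (intro tendsto_norm_zero LIM_zero)
  moreover have "\<forall>\<^sub>F s in at t within {0..}. norm ((T s x - T t x) /\<^sub>R (s - t) - T t w) =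
      norm (T s x - T t x - (s - t) *\<^sub>R T t w) / norm (s - t)"
    unfolding eventually_at_filter
  proof (intro always_eventually allI impI)
    fix s assume "s \<noteq> t"
    then have "(T s x - T t x) /\<^sub>R (s - t) - T t w = (T s x - T t x - (s - t) *\<^sub>R T t w) /\<^sub>R (s - t)"
      by (simp add: scaleR_diff_right)
    then show "norm ((T s x - T t x) /\<^sub>R (s - t) - T t w) =
        norm (T s x - T t x - (s - t) *\<^sub>R T t w) / norm (s - t)"
      by (simp add: divide_inverse mult.commute)
  qed
  ultimately have "((\<lambda>s. norm (T s x - T t x - (s - t) *\<^sub>R T t w) / norm (s - t)) \<longlongrightarrow> 0) (at t within {0..})"
    by (rule Lim_transform_eventually)
  then show ?thesis
    unfolding has_vector_derivative_def has_derivative_iff_norm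
    by (intro conjI bounded_linear_scaleR_left)
qed

end

section \<open>Semigroups on Hilbert spaces inherit properties of their generators\<close>
locale hilbert_space_semigroup = strongly_continuous_semigroup T
  for T :: "real \<Rightarrow> 'a::{real_inner, banach} \<Rightarrow> 'a" +
  assumes dense_domain: "closure (Domain infinitesimal_generator) = UNIV"
begin

text \<open>
  On the domain, \<open>\<parallel>T s x\<parallel>\<^sup>2\<close> has derivative \<open>2 (T s w \<bullet> T s x)\<close>, which is nonpositive because
  \<open>T s x\<close> is again in the domain with image \<open>T s w\<close>.  Density does the rest.
\<close>
lemma contraction:
  assumes dissipative: "\<And>x w. (x, w) \<in> infinitesimal_generator \<Longrightarrow> inner w x \<le> 0"
    and t: "0 \<le> t"
  shows "norm (T t x) \<le> norm x"
proof -
  have "norm (T t x) \<le> norm x" if x: "x \<in> Domain infinitesimal_generator" for x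
  proof -
    obtain w where xw: "(x, w) \<in> infinitesimal_generator" using x by blast
    have "((\<lambda>s. T s x \<bullet> T s x) has_derivative (\<lambda>h. h * (2 * (T s w \<bullet> T s x)))) (at s within {0..t})"
      if "0 \<le> s" for s
    proof -
      have "((\<lambda>s. T s x) has_derivative (\<lambda>h. h *\<^sub>R T s w)) (at s within {0..t})"
        using orbit_has_vector_derivative[OF xw that]
        by (auto simp: has_vector_derivative_def intro: has_derivative_subset)
      from has_derivative_inner[OF this this] show ?thesis
        by (rule has_derivative_eq_rhs) (auto simp: inner_commute algebra_simps)
    qed
    from mvt_very_simple[OF t this]
    obtain s where s: "s \<in> {0..t}" "T t x \<bullet> T t x - T 0 x \<bullet> T 0 x = (t - 0) * (2 * (T s w \<bullet> T s x))"
      by auto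
    have "T s w \<bullet> T s x \<le> 0"
      using dissipative generator_invariant[OF xw, of s] s(1) by auto
    then have "T t x \<bullet> T t x \<le> x \<bullet> x"
      using s(2) t mult_nonneg_nonpos[of t "2 * (T s w \<bullet> T s x)"] by (simp add: at_zero)
    then show ?thesis by (simp add: norm_eq_sqrt_inner)
  qed
  moreover have "closed {x. norm (T t x) \<le> norm x}"
    using t by (intro closed_Collect_le continuous_intros linear_continuous_on bounded_linear_at)
  ultimately show ?thesis
    using closure_minimal[of "Domain infinitesimal_generator" "{x. norm (T t x) \<le> norm x}"] dense_domain
    by blast
qed

text \<open>
  For \<open>x\<close>, \<open>y\<close> in the domain the function \<open>s \<mapsto> T s x \<bullet> T (t - s) y\<close> has derivative zero on \<open>[0, t]\<close> by
  symmetry of the generator; its values at the two endpoints are the two sides of the claim.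
\<close>
lemma symmetric:
  assumes symmetric_generator: "\<And>x w y v. (x, w) \<in> infinitesimal_generator \<Longrightarrow>
      (y, v) \<in> infinitesimal_generator \<Longrightarrow> w \<bullet> y = x \<bullet> v"
    and t: "0 \<le> t"
  shows "T t x \<bullet> y = x \<bullet> T t y"
proof -
  let ?D = "Domain infinitesimal_generator"
  have on_domain: "T t x \<bullet> y = x \<bullet> T t y" if x: "x \<in> ?D" and y: "y \<in> ?D" for x y
  proof -
    obtain w v where xw: "(x, w) \<in> infinitesimal_generator" and yv: "(y, v) \<in> infinitesimal_generator"
      using x y by blast
    have "((\<lambda>s. T s x \<bullet> T (t - s) y) has_derivative (\<lambda>h. 0)) (at s within {0..t})"
      if s: "0 \<le> s" "s \<le> t" for s
    proof -
      have x': "((\<lambda>s. T s x) has_derivative (\<lambda>h. h *\<^sub>R T s w)) (at s within {0..t})"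
        using orbit_has_vector_derivative[OF xw s(1)]
        by (auto simp: has_vector_derivative_def intro: has_derivative_subset)
      have "((\<lambda>s. t - s) has_vector_derivative -1) (at s within {0..t})"
        by (auto intro!: derivative_eq_intros)
      moreover have "((\<lambda>r. T r y) has_vector_derivative T (t - s) v)
          (at (t - s) within (\<lambda>s. t - s) ` {0..t})"
        using orbit_has_vector_derivative[OF yv, of "t - s"] s
        by (auto intro: has_vector_derivative_within_subset)
      ultimately have y': "((\<lambda>s. T (t - s) y) has_derivative (\<lambda>h. h *\<^sub>R - T (t - s) v)) (at s within {0..t})"
        using vector_diff_chain_within[of "\<lambda>s. t - s" "-1" s "{0..t}" "\<lambda>r. T r y" "T (t - s) v"]
        by (simp add: o_def has_vector_derivative_def)
      have "T s w \<bullet> T (t - s) y = T s x \<bullet> T (t - s) v"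
        using symmetric_generator generator_invariant[OF xw, of s] generator_invariant[OF yv, of "t - s"] s
        by simp
      then show ?thesis
        by (intro has_derivative_eq_rhs[OF has_derivative_inner[OF x' y']]) (auto simp: fun_eq_iff)
    qed
    from mvt_very_simple[OF t this] show ?thesis by (auto simp: at_zero)
  qed
  have cont: "continuous_on UNIV (T t)"
    using t by (intro linear_continuous_on bounded_linear_at)
  have half: "T t x \<bullet> y = x \<bullet> T t y" if x: "x \<in> ?D" for x y
  proof -
    have "closed {y. T t x \<bullet> y = x \<bullet> T t y}"
      by (intro closed_Collect_eq continuous_intros cont)
    then show ?thesis
      using closure_minimal[of ?D "{y. T t x \<bullet> y = x \<bullet> T t y}"] on_domain[OF x] dense_domain by blast
  qed
  have "closed {x. T t x \<bullet> y = x \<bullet> T t y}"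
    by (intro closed_Collect_eq continuous_intros cont)
  then show ?thesis
    using closure_minimal[of ?D "{x. T t x \<bullet> y = x \<bullet> T t y}"] half dense_domain by blast
qed

end

section \<open>Energy of mild solutions\<close>
text \<open>
  The step size does not depend on the position, so finitely many steps lead from \<open>0\<close> to \<open>a\<close>.
\<close>
lemma nonincreasing_if_uniformly_locally:
  fixes g :: "real \<Rightarrow> real"
  assumes \<delta>: "0 < \<delta>" and a: "0 \<le> a"
    and step: "\<And>s t. 0 \<le> s \<Longrightarrow> s \<le> t \<Longrightarrow> t \<le> a \<Longrightarrow> t - s < \<delta> \<Longrightarrow> g t \<le> g s"
  shows "g a \<le> g 0"
proof -
  obtain n :: nat where n: "a / \<delta> < real n"
    using reals_Archimedean2[of "a / \<delta>"] by blast
  then have pos: "0 < real n" using a \<delta> by (meson divide_nonneg_pos le_less_trans)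
  have small: "a / n < \<delta>"
    using n pos \<delta> by (simp add: field_simps)
  have "g (real k * (a / n)) \<le> g 0" if "k \<le> n" for k
    using that
  proof (induction k)
    case (Suc k)
    have "g (real (Suc k) * (a / n)) \<le> g (real k * (a / n))"
    proof (rule step)
      have "real (Suc k) * (a / n) \<le> real n * (a / n)"
        using Suc.prems a pos by (intro mult_right_mono) auto
      then show "real (Suc k) * (a / n) \<le> a" using pos by simp
    qed (use a pos small in \<open>auto simp: add_divide_distrib algebra_simps\<close>)
    with Suc show ?case by simp
  qed simp
  from this[of n] show ?thesis using pos by simp
qed

locale symmetric_contraction_semigroup = strongly_continuous_semigroup T
  for T :: "real \<Rightarrow> 'a::{real_inner, banach, second_countable_topology} \<Rightarrow> 'a" +
  assumes norm_le: "0 \<le> t \<Longrightarrow> norm (T t x) \<le> norm x"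
    and symmetric: "0 \<le> t \<Longrightarrow> T t x \<bullet> y = x \<bullet> T t y"
begin

definition mild_solution :: "'a \<Rightarrow> (real \<Rightarrow> 'a) \<Rightarrow> real \<Rightarrow> 'a" where
  "mild_solution x f t = T t x + (LINT \<tau>:{0..t}|lebesgue. T (t - \<tau>) (f \<tau>))"

text \<open>
  Truncating the time at zero makes \<open>(\<tau>, v) \<mapsto> T (max 0 (t - \<tau>)) v\<close> continuous on the whole product, so
  that composition with the measurable \<open>f\<close> is measurable.
\<close>
lemma convolution_measurable:
  assumes [measurable]: "f \<in> borel_measurable lebesgue"
  shows "(\<lambda>\<tau>. T (max 0 (t - \<tau>)) (f \<tau>)) \<in> borel_measurable lebesgue"
proof (rule borel_measurable_continuous_Pair[of "\<lambda>\<tau>. \<tau>" lebesgue f "\<lambda>\<tau> x. T (max 0 (t - \<tau>)) x"])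
  have "(\<lambda>\<tau>::real. \<tau>) \<in> borel_measurable borel" by simp
  then show "(\<lambda>\<tau>::real. \<tau>) \<in> borel_measurable lebesgue"
    by (intro measurable_completion) simp
  show "continuous_on UNIV (\<lambda>p :: real \<times> 'a. T (max 0 (t - fst p)) (snd p))"
    by (intro continuous_intros) auto
qed fact

lemma convolution_integrable:
  assumes "integrable lebesgue f" "S \<in> sets lebesgue" "S \<subseteq> {..t}"
  shows "set_integrable lebesgue S (\<lambda>\<tau>. T (t - \<tau>) (f \<tau>))"
proof -
  have [measurable]: "f \<in> borel_measurable lebesgue" using assms by simp
  have "integrable lebesgue (\<lambda>\<tau>. T (max 0 (t - \<tau>)) (f \<tau>))"
    by (rule Bochner_Integration.integrable_bound[OF assms(1)]) (auto simp: convolution_measurable norm_le)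
  then have "set_integrable lebesgue S (\<lambda>\<tau>. T (max 0 (t - \<tau>)) (f \<tau>))"
    using assms(2) unfolding set_integrable_def by (rule integrable_mult_indicator[rotated])
  then show ?thesis
    using assms(3) by (subst set_integrable_cong[OF refl refl]) (auto simp: subset_iff max_def)
qed

lemma mild_solution_alt:
  "mild_solution x f t = T t x + (LINT \<tau>|lebesgue. indicator {0..t} \<tau> *\<^sub>R T (max 0 (t - \<tau>)) (f \<tau>))"
  unfolding mild_solution_def set_lebesgue_integral_def
  by (intro arg_cong2[of _ _ _ _ "(+)"] refl Bochner_Integration.integral_cong) (auto simp: indicator_def)

lemma mild_solution_zero: "mild_solution x f 0 = x"
proof -
  have "(LINT \<tau>:{0..0}|lebesgue. T (0 - \<tau>) (f \<tau>)) = (LINT \<tau>|lebesgue. indicator {0::real} \<tau> *\<^sub>R f 0)"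
    unfolding set_lebesgue_integral_def
    by (intro Bochner_Integration.integral_cong) (auto simp: indicator_def at_zero)
  also have "\<dots> = 0" by simp
  finally show ?thesis by (simp add: mild_solution_def at_zero)
qed

text \<open>
  Dominated convergence with the majorant \<open>\<parallel>f\<parallel>\<close>; the integrands converge at every time other than
  the endpoint \<open>t\<close>.
\<close>
lemma mild_solution_continuous:
  assumes f: "integrable lebesgue f"
  shows "continuous_on {0..} (mild_solution x f)"
proof (rule continuous_on_sequentiallyI)
  fix r t assume r: "\<forall>n. r n \<in> {0..}" "t \<in> {0..}" "r \<longlonglongrightarrow> (t :: real)"
  have [measurable]: "f \<in> borel_measurable lebesgue" using f by simp
  have "(\<lambda>n. LINT \<tau>|lebesgue. indicator {0..r n} \<tau> *\<^sub>R T (max 0 (r n - \<tau>)) (f \<tau>))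
      \<longlonglongrightarrow> (LINT \<tau>|lebesgue. indicator {0..t} \<tau> *\<^sub>R T (max 0 (t - \<tau>)) (f \<tau>))"
  proof (rule integral_dominated_convergence[where w = "\<lambda>\<tau>. norm (f \<tau>)"])
    show "integrable lebesgue (\<lambda>\<tau>. norm (f \<tau>))" using f by simp
    show "(\<lambda>\<tau>. indicator {0..t} \<tau> *\<^sub>R T (max 0 (t - \<tau>)) (f \<tau>)) \<in> borel_measurable lebesgue" for t
      by (intro borel_measurable_scaleR convolution_measurable borel_measurable_indicator) auto
    then show "(\<lambda>\<tau>. indicator {0..r n} \<tau> *\<^sub>R T (max 0 (r n - \<tau>)) (f \<tau>)) \<in> borel_measurable lebesgue" for n .
    show "AE \<tau> in lebesgue. norm (indicator {0..r n} \<tau> *\<^sub>R T (max 0 (r n - \<tau>)) (f \<tau>)) \<le> norm (f \<tau>)" for n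
      by (intro AE_I2) (auto simp: indicator_def norm_le)
    have "AE \<tau> in lebesgue. \<tau> \<noteq> t"
      by (intro AE_completion AE_lborel_singleton)
    then show "AE \<tau> in lebesgue. (\<lambda>n. indicator {0..r n} \<tau> *\<^sub>R T (max 0 (r n - \<tau>)) (f \<tau>))
        \<longlonglongrightarrow> indicator {0..t} \<tau> *\<^sub>R T (max 0 (t - \<tau>)) (f \<tau>)"
    proof eventually_elim
      case (elim \<tau>)
      have "\<forall>\<^sub>F n in sequentially. indicator {0..t} \<tau> = (indicator {0..r n} \<tau> :: real)"
      proof (cases "\<tau> < t")
        case True
        from order_tendstoD(1)[OF r(3) this] show ?thesis
          by eventually_elim (use True in \<open>auto simp: indicator_def\<close>)
      next
        case False
        with elim have "t < \<tau>" by simp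
        from order_tendstoD(2)[OF r(3) this] show ?thesis
          by eventually_elim (use \<open>t < \<tau>\<close> in \<open>auto simp: indicator_def\<close>)
      qed
      then have "(\<lambda>n. indicator {0..r n} \<tau> :: real) \<longlonglongrightarrow> indicator {0..t} \<tau>"
        by (intro tendsto_eventually) (auto elim: eventually_mono)
      then show ?case
        by (intro tendsto_scaleR joint_tendsto tendsto_max tendsto_diff tendsto_const r(3)) auto
    qed
  qed
  moreover have "(\<lambda>n. T (r n) x) \<longlonglongrightarrow> T t x"
    using r by (intro orbit_tendsto) auto
  ultimately show "(\<lambda>n. mild_solution x f (r n)) \<longlonglongrightarrow> mild_solution x f t"
    unfolding mild_solution_alt by (intro tendsto_add)
qed

lemma mild_solution_restart:
  assumes f: "integrable lebesgue f" and st: "0 \<le> s" "s \<le> t"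
  shows "mild_solution x f t =
    T (t - s) (mild_solution x f s) + (LINT \<tau>:{s<..t}|lebesgue. T (t - \<tau>) (f \<tau>))"
proof -
  have "(LINT \<tau>:{0..t}|lebesgue. T (t - \<tau>) (f \<tau>)) = (LINT \<tau>:{0..s} \<union> {s<..t}|lebesgue. T (t - \<tau>) (f \<tau>))"
    using st by (intro arg_cong[of _ _ "\<lambda>S. set_lebesgue_integral lebesgue S _"]) auto
  also have "\<dots> = (LINT \<tau>:{0..s}|lebesgue. T (t - \<tau>) (f \<tau>)) + (LINT \<tau>:{s<..t}|lebesgue. T (t - \<tau>) (f \<tau>))"
    using st by (intro set_integral_Un convolution_integrable f) auto
  also have "(LINT \<tau>:{0..s}|lebesgue. T (t - \<tau>) (f \<tau>)) = (LINT \<tau>:{0..s}|lebesgue. T (t - s) (T (s - \<tau>) (f \<tau>)))"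
  proof (intro set_lebesgue_integral_cong allI impI)
    fix \<tau> assume "\<tau> \<in> {0..s}"
    then show "T (t - \<tau>) (f \<tau>) = T (t - s) (T (s - \<tau>) (f \<tau>))"
      using st semigroup[of "t - s" "s - \<tau>" "f \<tau>"] by simp
  qed simp
  also have "\<dots> = (LINT \<tau>|lebesgue. T (t - s) (indicator {0..s} \<tau> *\<^sub>R T (s - \<tau>) (f \<tau>)))"
    using st unfolding set_lebesgue_integral_def by (simp add: linearity)
  also have "\<dots> = T (t - s) (LINT \<tau>:{0..s}|lebesgue. T (s - \<tau>) (f \<tau>))"
    unfolding set_lebesgue_integral_def
    using st convolution_integrable[OF f, of "{0..s}" s]
    by (intro integral_bounded_linear bounded_linear_at) (auto simp: set_integrable_def)
  finally show ?thesis
    using st semigroup[of "t - s" s x] by (simp add: mild_solution_def linearity)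
qed

text \<open>
  Let \<open>w\<close> be the contribution of the input on \<open>(s, t]\<close>, so that \<open>T (t - s) (z s) = z t - w\<close>.  Expanding
  the square gives \<open>\<parallel>z t\<parallel>\<^sup>2 = \<parallel>T (t - s) (z s)\<parallel>\<^sup>2 + 2 (w \<bullet> z t) - \<parallel>w\<parallel>\<^sup>2\<close>.  The first term is
  controlled by contractivity, the last is dropped, and symmetry moves the semigroup in \<open>w \<bullet> z t\<close> from the
  input to the state.
\<close>
lemma energy_increment:
  fixes x :: 'a
  assumes f: "integrable lebesgue f" and st: "0 \<le> s" "s \<le> t"
  defines "z \<equiv> mild_solution x f"
  shows "(norm (z t))\<^sup>2 \<le> (norm (z s))\<^sup>2 + 2 * (LINT \<tau>:{s<..t}|lebesgue. f \<tau> \<bullet> T (t - \<tau>) (z t))"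
proof -
  define w where "w = (LINT \<tau>:{s<..t}|lebesgue. T (t - \<tau>) (f \<tau>))"
  have zt: "T (t - s) (z s) = z t - w"
    using mild_solution_restart[OF f st] by (simp add: z_def w_def)
  have int: "set_integrable lebesgue {s<..t} (\<lambda>\<tau>. T (t - \<tau>) (f \<tau>))"
    by (intro convolution_integrable f) auto
  have "w \<bullet> z t = (LINT \<tau>|lebesgue. (indicator {s<..t} \<tau> *\<^sub>R T (t - \<tau>) (f \<tau>)) \<bullet> z t)"
    unfolding w_def set_lebesgue_integral_def
    using int by (intro integral_inner_left[symmetric]) (auto simp: set_integrable_def)
  also have "\<dots> = (LINT \<tau>:{s<..t}|lebesgue. f \<tau> \<bullet> T (t - \<tau>) (z t))"
    unfolding set_lebesgue_integral_def
    by (intro Bochner_Integration.integral_cong) (auto simp: indicator_def symmetric)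
  finally have w: "w \<bullet> z t = \<dots>" .
  have "(norm (T (t - s) (z s)))\<^sup>2 \<le> (norm (z s))\<^sup>2"
    using st by (intro power_mono norm_le) auto
  moreover have "(norm (z t - w))\<^sup>2 = (norm (z t))\<^sup>2 - 2 * (w \<bullet> z t) + (norm w)\<^sup>2"
    by (simp add: power2_norm_eq_inner inner_diff_left inner_diff_right inner_commute)
  ultimately show ?thesis
    using zt w by (simp add: algebra_simps) (smt (verit) zero_le_power2)
qed

text \<open>
  The difference is a continuous function of \<open>(t, s)\<close> on a compact square that vanishes on the diagonal.
\<close>
lemma orbit_near_mild_solution:
  fixes x :: 'a
  assumes f: "integrable lebesgue f" and \<epsilon>: "0 < \<epsilon>"
  defines "z \<equiv> mild_solution x f"
  obtains \<delta> where "0 < \<delta>"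
    "\<And>s t. 0 \<le> s \<Longrightarrow> s \<le> t \<Longrightarrow> t \<le> a \<Longrightarrow> t - s < \<delta> \<Longrightarrow> norm (T (t - s) (z t) - z s) < \<epsilon>"
proof -
  define F where "F = (\<lambda>(t, s). T (max 0 (t - s)) (z t) - z s)"
  have z: "continuous_on {0..a} z"
    using mild_solution_continuous[OF f, of x] unfolding z_def by (rule continuous_on_subset) auto
  have "continuous_on ({0..a} \<times> {0..a}) F"
    unfolding F_def split_beta
    by (intro continuous_intros continuous_on_compose2[OF z]) auto
  then have "uniformly_continuous_on ({0..a} \<times> {0..a}) F"
    by (intro compact_uniformly_continuous compact_Times) auto
  then obtain \<delta> where \<delta>: "0 < \<delta>" "\<And>p q. p \<in> {0..a} \<times> {0..a} \<Longrightarrow> q \<in> {0..a} \<times> {0..a} \<Longrightarrow>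
      dist q p < \<delta> \<Longrightarrow> dist (F q) (F p) < \<epsilon>"
    using \<epsilon> unfolding uniformly_continuous_on_def by metis
  show thesis
  proof (rule that[OF \<delta>(1)])
    fix s t assume st: "0 \<le> s" "s \<le> t" "t \<le> a" "t - s < \<delta>"
    then have "dist (F (t, s)) (F (s, s)) < \<epsilon>"
      by (intro \<delta>(2)) (auto simp: dist_Pair_Pair dist_real_def)
    then show "norm (T (t - s) (z t) - z s) < \<epsilon>"
      using st by (simp add: F_def at_zero dist_norm)
  qed
qed

lemma supply_integrable:
  fixes a :: real and f :: "real \<Rightarrow> 'a"
  assumes f: "integrable lebesgue f" and z: "continuous_on {0..a} z"
  shows "set_integrable lebesgue {0..a} (\<lambda>\<tau>. f \<tau> \<bullet> z \<tau>)"
proof -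
  have [measurable]: "f \<in> borel_measurable lebesgue" using f by simp
  obtain K where K: "\<forall>\<tau>\<in>{0..a}. norm (z \<tau>) \<le> K"
    using compact_imp_bounded[OF compact_continuous_image[OF z]] compact_Icc[of 0 a]
    unfolding bounded_iff by auto
  have "(\<lambda>\<tau>. indicator {0..a} \<tau> *\<^sub>R z \<tau>) \<in> borel_measurable borel"
    using borel_measurable_continuous_on_indicator[OF _ z] by simp
  then have z': "(\<lambda>\<tau>. indicator {0..a} \<tau> *\<^sub>R z \<tau>) \<in> borel_measurable lebesgue"
    by (intro measurable_completion) simp
  have "integrable lebesgue (\<lambda>\<tau>. f \<tau> \<bullet> (indicator {0..a} \<tau> *\<^sub>R z \<tau>))"
  proof (rule Bochner_Integration.integrable_bound)
    show "integrable lebesgue (\<lambda>\<tau>. \<bar>K\<bar> * norm (f \<tau>))"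
      using f by (intro integrable_mult_right integrable_norm)
    show "(\<lambda>\<tau>. f \<tau> \<bullet> (indicator {0..a} \<tau> *\<^sub>R z \<tau>)) \<in> borel_measurable lebesgue"
      by (rule borel_measurable_inner[OF _ z']) simp
    have "norm (f \<tau> \<bullet> (indicator {0..a} \<tau> *\<^sub>R z \<tau>)) \<le> norm (\<bar>K\<bar> * norm (f \<tau>))" for \<tau>
    proof (cases "\<tau> \<in> {0..a}")
      case True
      have "norm (f \<tau> \<bullet> z \<tau>) \<le> norm (f \<tau>) * norm (z \<tau>)" by (simp add: Cauchy_Schwarz_ineq2)
      also have "\<dots> \<le> norm (f \<tau>) * \<bar>K\<bar>" using K True by (intro mult_left_mono) fastforce+
      finally show ?thesis using True by (simp add: mult.commute)
    qed simp
    then show "AE \<tau> in lebesgue. norm (f \<tau> \<bullet> (indicator {0..a} \<tau> *\<^sub>R z \<tau>)) \<le> norm (\<bar>K\<bar> * norm (f \<tau>))"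
      by simp
  qed
  then show ?thesis unfolding set_integrable_def by (simp add: mult.commute)
qed

text \<open>
  On a short interval the state \<open>T (t - \<tau>) (z t)\<close> in the energy increment differs from \<open>z \<tau>\<close> by less than
  \<open>\<epsilon>\<close>, with an error of at most \<open>2 \<epsilon>\<close> times the integral of \<open>\<parallel>f\<parallel>\<close> over that interval.  These errors add
  up over a partition of \<open>[0, a]\<close> to a multiple of \<open>\<epsilon>\<close>.
\<close>
lemma energy_inequality:
  fixes x :: 'a
  assumes f: "integrable lebesgue f" and a: "0 \<le> a"
  defines "z \<equiv> mild_solution x f"
  shows "(norm (z a))\<^sup>2 \<le> (norm x)\<^sup>2 + 2 * (LINT \<tau>:{0..a}|lebesgue. f \<tau> \<bullet> z \<tau>)"
proof (rule field_le_epsilon)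
  fix e :: real assume e: "0 < e"
  define N where "N = (LINT \<tau>:{0..a}|lebesgue. norm (f \<tau>))"
  \<comment> \<open>The summand 1 keeps the denominator positive when the input vanishes.\<close>
  define \<epsilon> where "\<epsilon> = e / (2 * (N + 1))"
  have "0 \<le> N" unfolding N_def set_lebesgue_integral_def by (intro integral_nonneg_AE) auto
  then have \<epsilon>: "0 < \<epsilon>" and \<epsilon>_le: "2 * \<epsilon> * N \<le> e"
    using e by (auto simp: \<epsilon>_def field_simps)
  obtain \<delta> where \<delta>: "0 < \<delta>"
    "\<And>s t. 0 \<le> s \<Longrightarrow> s \<le> t \<Longrightarrow> t \<le> a \<Longrightarrow> t - s < \<delta> \<Longrightarrow> norm (T (t - s) (z t) - z s) < \<epsilon>"
    using orbit_near_mild_solution[OF f \<epsilon>, of a x] unfolding z_def by blast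
  have supply_int: "set_integrable lebesgue {0..a} (\<lambda>\<tau>. f \<tau> \<bullet> z \<tau>)"
    using mild_solution_continuous[OF f, of x] unfolding z_def
    by (intro supply_integrable f) (auto intro: continuous_on_subset)
  have norm_f: "set_integrable lebesgue S (\<lambda>\<tau>. norm (f \<tau>))" if "S \<in> sets lebesgue" for S
    using f that unfolding set_integrable_def by (intro integrable_mult_indicator) auto
  \<comment> \<open>Stored energy minus supplied energy, with the error allowance subtracted as well.\<close>
  define g where "g t = (norm (z t))\<^sup>2 - 2 * (LINT \<tau>:{0..t}|lebesgue. f \<tau> \<bullet> z \<tau>)
      - 2 * \<epsilon> * (LINT \<tau>:{0..t}|lebesgue. norm (f \<tau>))" for t
  have "g a \<le> g 0"
  proof (rule nonincreasing_if_uniformly_locally[OF \<delta>(1) a])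
    fix s t assume st: "0 \<le> s" "s \<le> t" "t \<le> a" "t - s < \<delta>"
    have split: "(LINT \<tau>:{0..t}|lebesgue. h \<tau>) = (LINT \<tau>:{0..s}|lebesgue. h \<tau>) + (LINT \<tau>:{s<..t}|lebesgue. h \<tau>)"
      if "set_integrable lebesgue {0..a} h" for h :: "real \<Rightarrow> real"
    proof -
      have "{0..t} = {0..s} \<union> {s<..t}" using st by auto
      moreover have "set_integrable lebesgue {0..s} h" "set_integrable lebesgue {s<..t} h"
        using st by (auto intro!: set_integrable_subset[OF that])
      ultimately show ?thesis by (simp only:) (rule set_integral_Un, auto)
    qed
    have "set_integrable lebesgue {s<..t} (\<lambda>\<tau>. T (t - \<tau>) (f \<tau>))"
      by (intro convolution_integrable f) auto
    then have "integrable lebesgue (\<lambda>\<tau>. (indicator {s<..t} \<tau> *\<^sub>R T (t - \<tau>) (f \<tau>)) \<bullet> z t)"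
      unfolding set_integrable_def by (rule integrable_inner_left)
    then have "set_integrable lebesgue {s<..t} (\<lambda>\<tau>. T (t - \<tau>) (f \<tau>) \<bullet> z t)"
      by (simp add: set_integrable_def)
    then have int: "set_integrable lebesgue {s<..t} (\<lambda>\<tau>. f \<tau> \<bullet> T (t - \<tau>) (z t))"
      by (subst set_integrable_cong[OF refl refl]) (auto simp: symmetric)
    have int': "set_integrable lebesgue {s<..t} (\<lambda>\<tau>. f \<tau> \<bullet> z \<tau>)"
      using st by (intro set_integrable_subset[OF supply_int]) auto
    have "(LINT \<tau>:{s<..t}|lebesgue. f \<tau> \<bullet> T (t - \<tau>) (z t)) \<le>
        (LINT \<tau>:{s<..t}|lebesgue. f \<tau> \<bullet> z \<tau> + \<epsilon> * norm (f \<tau>))"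
    proof (rule set_integral_mono[OF int])
      show "set_integrable lebesgue {s<..t} (\<lambda>\<tau>. f \<tau> \<bullet> z \<tau> + \<epsilon> * norm (f \<tau>))"
        by (intro set_integral_add int' set_integrable_mult_right norm_f) auto
      fix \<tau> assume \<tau>: "\<tau> \<in> {s<..t}"
      have "f \<tau> \<bullet> (T (t - \<tau>) (z t) - z \<tau>) \<le> norm (f \<tau>) * norm (T (t - \<tau>) (z t) - z \<tau>)"
        by (rule norm_cauchy_schwarz)
      also have "\<dots> \<le> norm (f \<tau>) * \<epsilon>"
        using \<delta>(2)[of \<tau> t] st \<tau> by (intro mult_left_mono) auto
      finally show "f \<tau> \<bullet> T (t - \<tau>) (z t) \<le> f \<tau> \<bullet> z \<tau> + \<epsilon> * norm (f \<tau>)"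
        by (simp add: inner_diff_right algebra_simps)
    qed
    also have "\<dots> = (LINT \<tau>:{s<..t}|lebesgue. f \<tau> \<bullet> z \<tau>) + \<epsilon> * (LINT \<tau>:{s<..t}|lebesgue. norm (f \<tau>))"
      by (subst set_integral_add) (auto intro!: int' set_integrable_mult_right norm_f)
    finally show "g t \<le> g s"
      using energy_increment[OF f st(1,2), of x] split[OF supply_int] split[OF norm_f]
      by (simp add: g_def z_def algebra_simps)
  qed
  moreover have "(LINT \<tau>:{0..0}|lebesgue. h \<tau>) = 0" for h :: "real \<Rightarrow> real"
  proof -
    have "(LINT \<tau>:{0..0}|lebesgue. h \<tau>) = (LINT \<tau>|lebesgue. indicator {0::real} \<tau> *\<^sub>R h 0)"
      unfolding set_lebesgue_integral_def
      by (intro Bochner_Integration.integral_cong) (auto simp: indicator_def)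
    then show ?thesis by simp
  qed
  ultimately show "(norm (z a))\<^sup>2 \<le> (norm x)\<^sup>2 + 2 * (LINT \<tau>:{0..a}|lebesgue. f \<tau> \<bullet> z \<tau>) + e"
    using \<epsilon>_le mild_solution_zero[of x f] by (simp add: g_def z_def N_def)
qed

end

section \<open>The complex Hilbert space of square-integrable functions\<close>
lemma cinner_scaleC_left: "cinner (scaleC c f) g = c * cinner f g"
  by transfer (simp add: mult.assoc flip: sum_distrib_left)

lemma cinner_commute: "cinner g f = cnj (cinner f g)"
  by transfer (simp add: mult.commute flip: Bochner_Integration.integral_cnj)

text \<open>
  Through this identity, statements about the complex inner product follow from those about its real part
  as soon as the operators involved commute with multiplication by \<open>\<i>\<close>.
\<close>
lemma cinner_eq_Complex: "cinner f g = Complex (f \<bullet> g) (- (scaleC \<i> f \<bullet> g))"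
proof (rule complex_eqI)
  show "Im (cinner f g) = Im (Complex (f \<bullet> g) (- (scaleC \<i> f \<bullet> g)))"
    using Re_cinner[of "scaleC \<i> f" g] by (simp add: cinner_scaleC_left)
qed (simp add: Re_cinner)

lemma norm_scaleC: "norm (scaleC c f) = cmod c * norm f"
proof -
  have "complex_of_real ((norm (scaleC c f))\<^sup>2) = c * cnj c * complex_of_real ((norm f)\<^sup>2)"
    unfolding cinner_self[symmetric] cinner_scaleC_left
    by (subst cinner_commute) (simp add: cinner_scaleC_left flip: cinner_commute)
  also have "\<dots> = complex_of_real ((cmod c * norm f)\<^sup>2)"
    by (simp add: power_mult_distrib complex_norm_square del: of_real_power)
  finally show ?thesis
    by (simp only: of_real_eq_iff power2_eq_iff_nonneg norm_ge_zero mult_nonneg_nonneg)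
qed

lemma scaleC_add_right: "scaleC c (f + g) = scaleC c f + scaleC c g"
  by transfer (auto simp: L2_eq_def vector_add_ldistrib intro!: square_integrable_add square_integrable_scaleC)

lemma scaleC_scaleR: "scaleC c (r *\<^sub>R f) = r *\<^sub>R scaleC c f"
  by transfer (auto simp: L2_eq_def vec_eq_iff intro!: square_integrable_scaleR square_integrable_scaleC)

lemma bounded_linear_scaleC: "bounded_linear (scaleC c)"
  by (rule bounded_linear_intro[of _ "cmod c"])
     (auto simp: scaleC_add_right scaleC_scaleR norm_scaleC mult.commute)

lemma bounded_linear_cinner_left: "bounded_linear (\<lambda>f. cinner f g)"
proof -
  have "bounded_linear (\<lambda>f. complex_of_real (f \<bullet> g) - \<i> * complex_of_real (scaleC \<i> f \<bullet> g))"
    by (intro bounded_linear_sub bounded_linear_const_mult bounded_linear_compose[OF bounded_linear_of_real]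
        bounded_linear_compose[OF bounded_linear_inner_left] bounded_linear_ident bounded_linear_scaleC)
  then show ?thesis
    by (simp add: cinner_eq_Complex Complex_eq)
qed

lemma cinner_eqI:
  assumes "\<And>f. cinner f g = cinner f h"
  shows "g = h"
proof -
  have "(g - h) \<bullet> g = (g - h) \<bullet> h"
    using assms[of "g - h"] by (metis Re_cinner)
  then show ?thesis
    by (metis eq_iff_diff_eq_0 inner_diff_right inner_eq_zero_iff)
qed

lemma op_nonneg_identity: "op_nonneg (op_graph (\<lambda>z :: ('s::finite, 'n::finite) L2. z))"
  unfolding op_nonneg_def
proof (intro conjI)
  have "Domain (op_graph (\<lambda>z :: ('s, 'n) L2. z)) = UNIV"
    by (auto simp: op_graph_def)
  then show "densely_defined (op_graph (\<lambda>z :: ('s, 'n) L2. z))"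
    by (simp add: densely_defined_def)
  show "cadjoint (op_graph (\<lambda>z :: ('s, 'n) L2. z)) = op_graph (\<lambda>z. z)"
    by (auto simp: cadjoint_def op_graph_def intro: cinner_eqI)
  show "\<forall>(f, f')\<in>op_graph (\<lambda>z :: ('s, 'n) L2. z). cinner f' f \<in> \<real>\<^sub>\<ge>\<^sub>0"
    by (auto simp: op_graph_def cinner_self)
qed

section \<open>Systems of relaxation type\<close>
lemma op_nonpos_densely_defined:
  assumes nonpos: "op_nonpos A"
  shows "closure (Domain A) = UNIV"
proof -
  have "Domain (op_uminus A) = Domain A" by (auto simp: op_uminus_def)
  then show ?thesis
    using nonpos by (simp add: op_nonpos_def op_nonneg_def densely_defined_def)
qed

lemma op_nonpos_dissipative:
  assumes nonpos: "op_nonpos A" and "(f, f') \<in> A"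
  shows "f' \<bullet> f \<le> 0"
proof -
  have "(f, - f') \<in> op_uminus A" using assms by (auto simp: op_uminus_def)
  then have "cinner (- f') f \<in> \<real>\<^sub>\<ge>\<^sub>0"
    using nonpos by (auto simp: op_nonpos_def op_nonneg_def)
  then have "0 \<le> - f' \<bullet> f"
    unfolding Re_cinner[symmetric] by (auto simp: complex_nonneg_Reals_iff)
  then show ?thesis by simp
qed

lemma op_nonpos_symmetric:
  assumes nonpos: "op_nonpos A" and "(f, f') \<in> A" "(g, g') \<in> A"
  shows "f' \<bullet> g = f \<bullet> g'"
proof -
  have "(f, - f') \<in> op_uminus A" "(g, - g') \<in> cadjoint (op_uminus A)"
    using nonpos assms by (auto simp: op_uminus_def op_nonpos_def op_nonneg_def)
  then have "cinner (- f') g = cinner f (- g')"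
    by (auto simp: cadjoint_def)
  then have "- f' \<bullet> g = f \<bullet> - g'" by (metis Re_cinner)
  then show ?thesis by simp
qed

lemma op_exp_semigroup:
  assumes "\<exists>T. C0_semigroup T \<and> generator T = A"
  shows "C0_semigroup (op_exp A)" "generator (op_exp A) = A"
  using someI_ex[OF assms] by (auto simp: op_exp_def)

text \<open>
  The description of \<open>op_exp A\<close> by a choice operator suffices: every semigroup generated by \<open>A\<close> has these
  properties.
\<close>
lemma op_exp_symmetric_contraction_semigroup:
  fixes A :: "('s::finite, 'n::finite, 'n) op"
  assumes gen: "\<exists>T. C0_semigroup T \<and> generator T = A" and A: "op_nonpos A"
  shows "symmetric_contraction_semigroup (op_exp A)"
proof -
  interpret strongly_continuous_semigroup "op_exp A"
    using op_exp_semigroup(1)[OF gen]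
    by (intro strongly_continuous_semigroup.intro) (auto simp: C0_semigroup_def bounded_clinear_def)
  have gen_eq: "infinitesimal_generator = A"
    using op_exp_semigroup(2)[OF gen] by (simp add: infinitesimal_generator_def generator_def)
  interpret hilbert_space_semigroup "op_exp A"
    by unfold_locales (simp add: gen_eq op_nonpos_densely_defined[OF A])
  show ?thesis
  proof unfold_locales
    fix t :: real and x y :: "('s, 'n) L2"
    assume t: "0 \<le> t"
    show "norm (op_exp A t x) \<le> norm x"
      by (rule contraction[OF _ t]) (simp add: gen_eq op_nonpos_dissipative[OF A])
    show "op_exp A t x \<bullet> y = x \<bullet> op_exp A t y"
      by (rule symmetric[OF _ t]) (simp add: gen_eq op_nonpos_symmetric[OF A])
  qed
qed

lemma cinner_op_exp:
  assumes gen: "\<exists>T. C0_semigroup T \<and> generator T = A" and A: "op_nonpos A" and t: "0 \<le> t"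
  shows "cinner (op_exp A t f) g = cinner f (op_exp A t g)"
proof -
  interpret symmetric_contraction_semigroup "op_exp A"
    by (rule op_exp_symmetric_contraction_semigroup[OF gen A])
  have "scaleC \<i> (op_exp A t f) = op_exp A t (scaleC \<i> f)"
    using op_exp_semigroup(1)[OF gen] t by (simp add: C0_semigroup_def bounded_clinear_def)
  then show ?thesis
    using t by (simp add: cinner_eq_Complex symmetric)
qed

lemma cinner_adjoint:
  assumes "op_graph B = cadjoint (op_graph C)"
  shows "cinner u (C z) = cinner (B u) z"
proof -
  have "(u, B u) \<in> cadjoint (op_graph C)"
    unfolding assms[symmetric] by (simp add: op_graph_def)
  then have "cinner (C z) u = cinner z (B u)"
    by (auto simp: cadjoint_def op_graph_def)
  then show ?thesis by (metis cinner_commute)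
qed

text \<open>
  On a bounded interval square integrability implies integrability, by \<open>r \<le> 1 + r\<^sup>2\<close>.
\<close>
lemma input_integrable:
  assumes B: "bounded_clinear B" and u: "L2_input t u"
  shows "integrable lebesgue (\<lambda>\<tau>. indicator {0..t} \<tau> *\<^sub>R B (u \<tau>))"
proof -
  have bl: "bounded_linear B" using B by (simp add: bounded_clinear_def)
  have meas: "(\<lambda>\<tau>. indicator {0..t} \<tau> *\<^sub>R u \<tau>) \<in> borel_measurable lebesgue"
    using u by (simp add: L2_input_def set_borel_measurable_def)
  have "integrable lebesgue (\<lambda>\<tau>. indicator {0..t} \<tau> + indicator {0..t} \<tau> *\<^sub>R (norm (u \<tau>))\<^sup>2 :: real)"
    using u by (intro Bochner_Integration.integrable_add)
      (auto simp: L2_input_def set_integrable_def emeasure_lborel_Icc_eq)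
  then have "integrable lebesgue (\<lambda>\<tau>. indicator {0..t} \<tau> *\<^sub>R u \<tau>)"
  proof (rule Bochner_Integration.integrable_bound[OF _ meas])
    have "r \<le> 1 + r\<^sup>2" if "0 \<le> r" for r :: real
      using sum_squares_bound[of 1 r] that by simp
    then show "AE \<tau> in lebesgue. norm (indicator {0..t} \<tau> *\<^sub>R u \<tau>)
        \<le> norm (indicator {0..t} \<tau> + indicator {0..t} \<tau> *\<^sub>R (norm (u \<tau>))\<^sup>2 :: real)"
      by (intro AE_I2) (auto simp: indicator_def)
  qed
  from integrable_bounded_linear[OF bl this] show ?thesis
    by (simp add: linear_simps(5)[OF bl])
qed

text \<open>
  The supply rate is \<open>2 Re \<langle>u, C z\<rangle> = 2 Re \<langle>B u, z\<rangle>\<close>, which is the one in the energy inequality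
  for the mild solution driven by \<open>B u\<close>.
\<close>
theorem impedance_passive:
  fixes A :: "('s::finite, 'n::finite, 'n) op"
    and B :: "('s, 'm::finite) L2 \<Rightarrow> ('s, 'n) L2"
    and C :: "('s, 'n) L2 \<Rightarrow> ('s, 'm) L2"
  assumes gen: "\<exists>T. C0_semigroup T \<and> generator T = A" and A: "op_nonpos A"
    and B: "bounded_clinear B" and adj: "op_graph B = cadjoint (op_graph C)"
  shows "impedance_passive_with A B C (\<lambda>z. (norm z)\<^sup>2)"
  unfolding impedance_passive_with_def Let_def
proof (intro conjI allI impI)
  have "bounded_clinear (\<lambda>z :: ('s, 'n) L2. z)"
    by (simp add: bounded_clinear_def bounded_linear_ident)
  then show "\<exists>Q. bounded_clinear Q \<and> op_nonneg (op_graph Q) \<and>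
      (\<forall>z :: ('s, 'n) L2. complex_of_real ((norm z)\<^sup>2) = cinner (Q z) z)"
    by (intro exI[of _ "\<lambda>z. z"]) (simp add: op_nonneg_identity cinner_self)
next
  fix z0 t and u :: "real \<Rightarrow> ('s, 'm) L2"
  assume t: "0 \<le> t" and u: "L2_input t u"
  interpret symmetric_contraction_semigroup "op_exp A"
    by (rule op_exp_symmetric_contraction_semigroup[OF gen A])
  \<comment> \<open>Cutting off the input outside \<open>[0, t]\<close> makes it integrable over the whole line and leaves the states up to \<open>t\<close> unchanged.\<close>
  define f where "f \<tau> = indicator {0..t} \<tau> *\<^sub>R B (u \<tau>)" for \<tau>
  have f: "integrable lebesgue f"
    unfolding f_def[abs_def] by (rule input_integrable[OF B u])
  have mild: "mild_solution z0 f \<tau> = mild_state A B z0 u \<tau>" if "\<tau> \<le> t" for \<tau>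
    unfolding mild_solution_def mild_state_def
    using that by (intro arg_cong2[of _ _ _ _ "(+)"] refl set_lebesgue_integral_cong) (auto simp: f_def)
  have "(LINT \<tau>:{0..t}|lebesgue. cinner (u \<tau>) (C (mild_state A B z0 u \<tau>)) + cinner (C (mild_state A B z0 u \<tau>)) (u \<tau>))
      = (LINT \<tau>:{0..t}|lebesgue. complex_of_real (2 * (f \<tau> \<bullet> mild_solution z0 f \<tau>)))"
  proof (intro set_lebesgue_integral_cong allI impI)
    fix \<tau> assume \<tau>: "\<tau> \<in> {0..t}"
    have "cinner (u \<tau>) v + cinner v (u \<tau>) = complex_of_real (2 * (u \<tau> \<bullet> v))" for v
      by (simp add: complex_eq_iff Re_cinner inner_commute) (subst cinner_commute, simp)
    moreover have "u \<tau> \<bullet> C (mild_state A B z0 u \<tau>) = f \<tau> \<bullet> mild_solution z0 f \<tau>"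
      using \<tau> cinner_adjoint[OF adj, of "u \<tau>" "mild_state A B z0 u \<tau>"]
      by (simp add: mild f_def flip: Re_cinner)
    ultimately show "cinner (u \<tau>) (C (mild_state A B z0 u \<tau>)) + cinner (C (mild_state A B z0 u \<tau>)) (u \<tau>)
        = complex_of_real (2 * (f \<tau> \<bullet> mild_solution z0 f \<tau>))" by simp
  qed simp
  also have "\<dots> = complex_of_real (2 * (LINT \<tau>:{0..t}|lebesgue. f \<tau> \<bullet> mild_solution z0 f \<tau>))"
    by (subst set_integral_complex_of_real) simp
  finally show "(norm (mild_state A B z0 u t))\<^sup>2 \<le> (norm z0)\<^sup>2 +
      Re (LINT \<tau>:{0..t}|lebesgue. cinner (u \<tau>) (C (mild_state A B z0 u \<tau>)) + cinner (C (mild_state A B z0 u \<tau>)) (u \<tau>))"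
    using energy_inequality[OF f t, of z0] by (simp add: mild)
qed

text \<open>
  After time zero the input vanishes and the state evolves freely, \<open>z t = T t (z 0)\<close>.  Hence
  \<open>\<langle>u (-t), C (z t)\<rangle> = \<langle>B (u (-t)), T t (z 0)\<rangle> = \<langle>T t (B (u (-t))), z 0\<rangle>\<close>, and
  \<open>z 0\<close> is precisely the integral of \<open>T t (B (u (-t)))\<close> over \<open>t \<ge> 0\<close>: the self-adjoint semigroup lets
  the past input and the future output be paired through the same kernel.
\<close>
theorem stored_energy_eq_correlation:
  fixes A :: "('s::finite, 'n::finite, 'n) op"
    and B :: "('s, 'm::finite) L2 \<Rightarrow> ('s, 'n) L2"
    and C :: "('s, 'n) L2 \<Rightarrow> ('s, 'm) L2"
  assumes gen: "\<exists>T. C0_semigroup T \<and> generator T = A" and A: "op_nonpos A"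
    and B: "bounded_clinear B" and adj: "op_graph B = cadjoint (op_graph C)"
    and rest: "rest_integrable A B u" and u: "\<forall>t\<ge>0. u t = 0"
  defines "z \<equiv> rest_state A B u"
  shows "set_integrable lebesgue {0..} (\<lambda>t. cinner (u (- t)) (C (z t)))" (is ?int)
    and "complex_of_real ((norm (z 0))\<^sup>2) = (LINT t:{0..}|lebesgue. cinner (u (- t)) (C (z t)))" (is ?eq)
proof -
  interpret symmetric_contraction_semigroup "op_exp A"
    by (rule op_exp_symmetric_contraction_semigroup[OF gen A])
  have B0: "B 0 = 0"
    using B by (auto simp: bounded_clinear_def intro: linear_simps(3))
  define k where "k \<tau> = indicator {..0::real} \<tau> *\<^sub>R op_exp A (- \<tau>) (B (u \<tau>))" for \<tau>
  have k: "integrable lebesgue k"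
    using rest unfolding rest_integrable_def set_integrable_def k_def[abs_def] by (auto dest: spec[of _ 0])
  have z0: "z 0 = (LINT \<tau>|lebesgue. k \<tau>)"
    by (simp add: z_def rest_state_def set_lebesgue_integral_def k_def)
  have z: "z t = op_exp A t (z 0)" if t: "0 \<le> t" for t
  proof -
    have "z t = (LINT \<tau>|lebesgue. op_exp A t (k \<tau>))"
      unfolding z_def rest_state_def set_lebesgue_integral_def
    proof (intro Bochner_Integration.integral_cong refl)
      fix \<tau>
      show "indicator {..t} \<tau> *\<^sub>R op_exp A (t - \<tau>) (B (u \<tau>)) = op_exp A t (k \<tau>)"
        using t u B0 semigroup[of t "- \<tau>" "B (u \<tau>)"]
        by (cases "\<tau> \<le> 0") (auto simp: k_def indicator_def linearity)
    qed
    then show ?thesis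
      using integral_bounded_linear[OF bounded_linear_at[OF t] k] by (simp add: z0)
  qed
  have eq: "indicator {0..} t *\<^sub>R cinner (u (- t)) (C (z t)) = cinner (k (- t)) (z 0)" for t
  proof (cases "0 \<le> t")
    case True
    have "cinner (u (- t)) (C (z t)) = cinner (B (u (- t))) (op_exp A t (z 0))"
      by (simp add: cinner_adjoint[OF adj] z[OF True])
    also have "\<dots> = cinner (op_exp A t (B (u (- t)))) (z 0)"
      by (simp add: cinner_op_exp[OF gen A True])
    finally show ?thesis using True by (simp add: k_def)
  next
    case False
    then show ?thesis
      using linear_simps(3)[OF bounded_linear_cinner_left] by (simp add: k_def)
  qed
  have int: "integrable lebesgue (\<lambda>\<tau>. cinner (k \<tau>) (z 0))"
    by (rule integrable_bounded_linear[OF bounded_linear_cinner_left k])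
  have "integrable lebesgue (\<lambda>t. cinner (k (- t)) (z 0))"
    using lebesgue_integrable_real_affine[OF int, of "-1" 0] by simp
  then show ?int
    unfolding set_integrable_def eq .
  have "complex_of_real ((norm (z 0))\<^sup>2) = cinner (LINT \<tau>|lebesgue. k \<tau>) (z 0)"
    by (simp only: cinner_self[symmetric] z0[symmetric])
  also have "\<dots> = (LINT \<tau>|lebesgue. cinner (k \<tau>) (z 0))"
    by (rule integral_bounded_linear[OF bounded_linear_cinner_left k, symmetric])
  also have "\<dots> = (LINT t|lebesgue. cinner (k (- t)) (z 0))"
    using lebesgue_integral_real_affine[of "-1" "\<lambda>\<tau>. cinner (k \<tau>) (z 0)" 0] by simp
  finally show ?eq
    unfolding set_lebesgue_integral_def eq .
qed

theorem theorem4: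
  fixes A :: "(('s::finite, 'n::finite) L2 \<times> ('s, 'n) L2) set"
    and B :: "('s, 'm::finite) L2 \<Rightarrow> ('s, 'n) L2"
    and C :: "('s, 'n) L2 \<Rightarrow> ('s, 'm) L2"
  assumes "ltsi_system A B C" and "internally_relaxation A B C"
  shows "impedance_passive_with A B C (\<lambda>z. (norm z)\<^sup>2) \<and>
    (\<forall>u. rest_integrable A B u \<longrightarrow> (\<forall>t\<ge>0. u t = 0) \<longrightarrow>
       (let z = rest_state A B u; y = (\<lambda>t. C (z t))
        in set_integrable lebesgue {0..} (\<lambda>t. cinner (u (- t)) (y t)) \<and>
           complex_of_real ((norm (z 0))\<^sup>2) = (LINT t:{0..}|lebesgue. cinner (u (- t)) (y t))))"
proof -
  have gen: "\<exists>T. C0_semigroup T \<and> generator T = A" and B: "bounded_clinear B"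
    using assms(1) by (auto simp: ltsi_system_def)
  have A: "op_nonpos A" and adj: "op_graph B = cadjoint (op_graph C)"
    using assms(2) by (auto simp: internally_relaxation_def)
  show ?thesis
    unfolding Let_def
    using impedance_passive[OF gen A B adj] stored_energy_eq_correlation[OF gen A B adj] by blast
qed

end
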